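(* For every $\delta\in[0,1)$ and every $\alpha\in(\delta/3,1/3)$ there exists $\epsilon>0$ with the following property. For all constants $0<c_1\le c_2$ there are $C>0$ and $n_0$ such that for all $n\ge n_0$, setting $N=2n-2$, for every prime $p$ with $c_1N^\alpha\le p\le c_2N^\alpha$, every real $k\ge1$ and bias $b$ with $H(B_b)=1/k$, every integer $\ell\le kN+N^\delta$ and every $(\epsilon\log N)^{1/2}$-local function $f:\{0,1\}^\ell\to\{0,1\}^{N+1}$, $$\Delta\big(f(B_b^{\otimes\ell}),\,(Z,\mathrm{pmmajmod}_p(Z))\big)\ \ge\ \tfrac12-\tfrac{C}{\log N},$$ where $Z$ is uniform on $\{0,1\}^N$.
   Context: $B_b$ ($b\in[-1/2,1/2]$) is the Bernoulli random variable equal to $0$ with probability $1/2+b$ and $1$ with probability $1/2-b$; $H(B_b)$ is its binary entropy (in bits); $B_b^{\otimes\ell}$ is $\ell$ i.i.d. copies. Binary tree $B_n$: vertices $v_0,\dots,v_{n-1}$, root $v_0$; for $i\ge1$ the parent of $v_i$ is $v_{\lfloor(i-1)/2\rfloor}$ and $e_i$ joins $v_i$ to its parent. For $d\in\{0,1\}^{n-1}$, $h(d)_i=\bigoplus_{j:\,e_j\text{ on the path }v_0\to v_i}d_j$. For odd prime $p$ and integer $a$, $\mathrm{MM}_p(a)=0$ if $(a\bmod p)\in\{0,\dots,(p-1)/2\}$ and $1$ otherwise. For $z=(d,x)\in\{0,1\}^{n-1}\times\{0,1\}^{n-1}$, $\mathrm{pmmajmod}_p(z)=\mathrm{MM}_p(\sum_{i=1}^{n-1}x_i(-1)^{h(d)_i})\oplus\mathrm{parity}(x)$.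 A function is $d$-local if each output bit depends on at most $d$ input bits. $\Delta$ is total variation distance. *)

theory Defs
  imports "HOL-Probability.Probability"
begin

text \<open>Bit strings of length m are functions nat => bool that are False outside {..<m};
  True encodes the bit 1.\<close>

definition bitstrings :: "nat \<Rightarrow> (nat \<Rightarrow> bool) set" where
  "bitstrings m = {x. \<forall>i. i \<ge> m \<longrightarrow> \<not> x i}"

definition Bern :: "real \<Rightarrow> bool pmf" where
  "Bern b = bernoulli_pmf (1/2 - b)"

definition Bern_pow :: "real \<Rightarrow> nat \<Rightarrow> (nat \<Rightarrow> bool) pmf" where
  "Bern_pow b l = Pi_pmf {..<l} False (\<lambda>_. Bern b)"

definition unif_bits :: "nat \<Rightarrow> (nat \<Rightarrow> bool) pmf" where
  "unif_bits m = Pi_pmf {..<m} False (\<lambda>_. bernoulli_pmf (1/2))"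

definition binH :: "real \<Rightarrow> real" where
  "binH b = (let q = 1/2 + b in
     - (if q = 0 then 0 else q * log 2 q) - (if q = 1 then 0 else (1 - q) * log 2 (1 - q)))"

definition tv_dist :: "'a pmf \<Rightarrow> 'a pmf \<Rightarrow> real" where
  "tv_dist P Q = (SUP A. \<bar>measure_pmf.prob P A - measure_pmf.prob Q A\<bar>)"

text \<open>Edges on the path from the root v_0 to v_i in the binary tree B_n: e_j for j an
  ancestor-or-self of i with j >= 1; parent of v_(m+1) is v_(m div 2).\<close>
fun path_edges :: "nat \<Rightarrow> nat set" where
  "path_edges 0 = {}"
| "path_edges (Suc m) = insert (Suc m) (path_edges (m div 2))"

definition hbit :: "(nat \<Rightarrow> bool) \<Rightarrow> nat \<Rightarrow> bool" where
  "hbit d i = odd (card {j \<in> path_edges i. d j})"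

definition MM :: "int \<Rightarrow> int \<Rightarrow> bool" where
  "MM p a = (a mod p \<notin> {0..(p - 1) div 2})"

text \<open>pmmajmod_p on z = (d,x), d and x indexed by 1..n-1.\<close>
definition pmmajmod :: "nat \<Rightarrow> nat \<Rightarrow> (nat \<Rightarrow> bool) \<Rightarrow> (nat \<Rightarrow> bool) \<Rightarrow> bool" where
  "pmmajmod p n d x =
     (MM (int p) (\<Sum>i\<in>{1..n-1}. (if x i then 1 else 0) * (if hbit d i then -1 else 1))
      \<noteq> odd (card {i \<in> {1..n-1}. x i}))"

definition pmm_bits :: "nat \<Rightarrow> nat \<Rightarrow> (nat \<Rightarrow> bool) \<Rightarrow> bool" where
  "pmm_bits p n z = pmmajmod p n (\<lambda>j. z (j - 1)) (\<lambda>i. z (n - 2 + i))"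

definition target_dist :: "nat \<Rightarrow> nat \<Rightarrow> (nat \<Rightarrow> bool) pmf" where
  "target_dist p n = (let N = 2*n - 2 in
     map_pmf (\<lambda>z j. if j < N then z j else if j = N then pmm_bits p n z else False) (unif_bits N))"

definition is_local :: "real \<Rightarrow> nat \<Rightarrow> nat \<Rightarrow> ((nat \<Rightarrow> bool) \<Rightarrow> (nat \<Rightarrow> bool)) \<Rightarrow> bool" where
  "is_local d l m f = (\<forall>j<m. \<exists>S \<subseteq> {..<l}. real (card S) \<le> d \<and>
      (\<forall>x\<in>bitstrings l. \<forall>y\<in>bitstrings l. (\<forall>i\<in>S. x i = y i) \<longrightarrow> f x j = f y j))"

definition push :: "nat \<Rightarrow> ((nat \<Rightarrow> bool) \<Rightarrow> (nat \<Rightarrow> bool)) \<Rightarrow> (nat \<Rightarrow> bool) pmf \<Rightarrow> (nat \<Rightarrow> bool) pmf" where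
  "push m f D = map_pmf (\<lambda>x j. if j < m then f x j else False) D"

end

theory Submission
  imports Defs "HOL-Real_Asymp.Real_Asymp"
begin

text \<open>
  Replacing the edge bits \<open>d\<close> by the vertex bits \<open>h(d)\<close> is a bijection, so the target is a uniform
  pair \<open>(h, x)\<close> of vertex labellings together with one bit. Discard the few inputs that touch the last
  bit, an edge near the root, or too many vertices. Among the others, a greedy choice gives almost
  linearly many inputs \<open>i \<in> I\<close> that influence small, pairwise disjoint blocks of vertices. Fix the
  inputs outside \<open>I\<close>. There are three cases.

  If many blocks do not react to their input, the output has lost entropy and is typically an atom of
  mass far above \<open>2^-N\<close>; the uniform distribution rarely hits the set of such atoms. If only few blocks
  can take the pattern \<open>h = 0, x = 1\<close>, the output shows fewer such blocks than a uniform string does.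
  Otherwise many blocks take this pattern for one value of their input and another pattern for the
  other. As it is the only pattern of maximal weight, the block weight varies modulo \<open>p\<close>, and a
  Fourier estimate makes the correct last bit nearly unbiased, while the sampled last bit is constant:
  it is wrong with probability about one half.

  If the source has too little entropy for this argument, the first test alone gives distance
  close to 1.
\<close>

section \<open>Path parities in the binary tree\<close>

text \<open>A path to the root has logarithmic length, so a label h may depend on too many inputs.
  Few edges lie near the root, however: discarding the inputs of the first K/2^r edges costs little
  and leaves at most r relevant edges on every path. With locality D the blocks then have O(D^2)
  vertices, and a uniform string makes a block special with probability at least 4^(-O(D^2)). This
  must stay above a small negative power of N, whence the locality bound sqrt(\<epsilon> log N).

  The case distinction is made at about M = N^\<beta> blocks. M lost inputs must outweigh N^\<delta>
  surplus inputs, so \<beta> > \<delta>; M damping factors of about 1 - 1/p^2 must make the Fourier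
  sum small, with p^2 of order at most N^(2/3), so \<beta> > 2/3; and the special blocks must
  outnumber N^\<beta> after all losses, so \<beta> < 1.

  As k is not bounded, the source may be extremely biased, which would ruin both the damping and the
  entropy estimate. Then the inputs that f reads carry too little entropy; in the remaining case q
  and 1 - q are at least 1/(256 log N).\<close>

lemma finite_path_edges [simp]: "finite (path_edges m)"
  by (induction m rule: path_edges.induct) auto

lemma path_edges_bounds: "j \<in> path_edges m \<Longrightarrow> 1 \<le> j \<and> j \<le> m"
proof (induction m rule: path_edges.induct)
  case (2 m)
  then show ?case by (auto dest: order_trans[OF _ div_le_dividend])
qed simp

lemma hbit_Suc: "hbit d (Suc m) \<longleftrightarrow> hbit d (m div 2) \<noteq> d (Suc m)"
proof -
  have "Suc m \<notin> path_edges (m div 2)"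
    using path_edges_bounds[of "Suc m" "m div 2"] div_le_dividend[of m 2] by linarith
  moreover have "{j \<in> path_edges (Suc m). d j} =
      (if d (Suc m) then insert (Suc m) {j \<in> path_edges (m div 2). d j}
       else {j \<in> path_edges (m div 2). d j})"
    by auto
  ultimately show ?thesis unfolding hbit_def by auto
qed

lemma hbit_cong:
  assumes "\<And>j. j \<in> path_edges m \<Longrightarrow> d j = d' j"
  shows "hbit d m = hbit d' m"
proof -
  have "{j \<in> path_edges m. d j} = {j \<in> path_edges m. d' j}" using assms by auto
  then show ?thesis unfolding hbit_def by simp
qed

text \<open>An edge bit is the XOR of the labels of its two ends, and the root has label
  \<open>False\<close>.\<close>

lemma hbit_determines_edges:
  assumes "\<And>m. m \<in> {1..K} \<Longrightarrow> hbit d m = hbit d' m" and "j \<in> {1..K}"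
  shows "d j = d' j"
proof -
  obtain m where j: "j = Suc m" using assms(2) by (cases j) auto
  have "hbit d (m div 2) = hbit d' (m div 2)"
  proof (cases "m div 2 = 0")
    case True then show ?thesis by (simp add: hbit_def)
  next
    case False
    then have "m div 2 \<in> {1..K}" using assms(2) j div_le_dividend[of m 2]
      unfolding atLeastAtMost_iff by linarith
    then show ?thesis by (rule assms(1))
  qed
  then show ?thesis using assms(1)[OF assms(2)] unfolding j hbit_Suc by auto
qed

text \<open>Each step to the parent at least halves the index, so after r steps the path has index
  below a and meets no further edge that counts.\<close>

lemma card_low_path_edges:
  "m < a * 2 ^ r \<Longrightarrow> card {j \<in> path_edges m. a \<le> j} \<le> r"
proof (induction r arbitrary: m)
  case 0
  then have "{j \<in> path_edges m. a \<le> j} = {}" by (auto dest: path_edges_bounds)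
  then show ?case by simp
next
  case (Suc r)
  show ?case
  proof (cases m)
    case (Suc k)
    have "k div 2 < a * 2 ^ r" using Suc.prems Suc by auto
    then have c: "card {j \<in> path_edges (k div 2). a \<le> j} \<le> r" by (rule Suc.IH)
    have "{j \<in> path_edges m. a \<le> j} \<subseteq> insert m {j \<in> path_edges (k div 2). a \<le> j}"
      using Suc by auto
    then have "card {j \<in> path_edges m. a \<le> j} \<le>
        card (insert m {j \<in> path_edges (k div 2). a \<le> j})"
      by (intro card_mono) auto
    also have "\<dots> \<le> Suc (card {j \<in> path_edges (k div 2). a \<le> j})" by (simp add: card_insert_if)
    finally show ?thesis using c by simp
  qed simp
qed

text \<open>With n = K + 1, positions below K hold the edge bits d_1, ..., d_K and positions K, ...,
  2 K - 1 hold x_1, ..., x_K; hence the two shifts.\<close>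

definition vtx :: "nat \<Rightarrow> (nat \<Rightarrow> bool) \<Rightarrow> nat \<Rightarrow> bool \<times> bool" where
  "vtx K z m = (hbit (\<lambda>j. z (j - 1)) m, z (K - 1 + m))"

definition wt :: "bool \<times> bool \<Rightarrow> int" where
  "wt w = (if snd w then 1 else 0) * (if fst w then - 1 else 1)"

text \<open>Signs turn XOR into multiplication, so that the parity of x factorises over vertices and
  later over independent inputs.\<close>

definition sgnb :: "bool \<Rightarrow> real" where
  "sgnb c = (if c then - 1 else 1)"

lemma sgnb_odd_card:
  assumes "finite A"
  shows "sgnb (odd (card {m \<in> A. P m})) = (\<Prod>m\<in>A. sgnb (P m))"
  using assms
proof (induction A rule: finite_induct)
  case (insert a A)
  have split: "card {m \<in> insert a A. P m} = (if P a then 1 else 0) + card {m \<in> A. P m}"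
  proof (cases "P a")
    case True
    then have "{m \<in> insert a A. P m} = insert a {m \<in> A. P m}" by auto
    then show ?thesis using insert True by simp
  next
    case False
    then have "{m \<in> insert a A. P m} = {m \<in> A. P m}" by auto
    then show ?thesis using False by simp
  qed
  have "sgnb (odd (card {m \<in> insert a A. P m})) = sgnb (P a) * sgnb (odd (card {m \<in> A. P m}))"
    unfolding split sgnb_def by (cases "P a") simp_all
  then show ?case using insert by simp
qed (simp add: sgnb_def)

lemma sgnb_neq: "sgnb (a \<noteq> b) = sgnb a * sgnb b"
  by (auto simp: sgnb_def)

lemma sgnb_pmm_bits:
  assumes "K \<ge> 1"
  shows "sgnb (pmm_bits p (Suc K) z) =
    sgnb (MM (int p) (\<Sum>m\<in>{1..K}. wt (vtx K z m))) * (\<Prod>m\<in>{1..K}. sgnb (snd (vtx K z m)))"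
  unfolding pmm_bits_def pmmajmod_def sgnb_neq
  by (subst sgnb_odd_card) (simp_all add: vtx_def wt_def)

lemma vtx_determines_bits:
  assumes "\<And>m. m \<in> {1..K} \<Longrightarrow> vtx K z m = vtx K z' m" and "j < 2 * K"
  shows "z j = z' j"
proof (cases "j < K")
  case True
  have "z (Suc j - 1) = z' (Suc j - 1)"
    by (rule hbit_determines_edges[of K "\<lambda>j. z (j - 1)" "\<lambda>j. z' (j - 1)" "Suc j"])
      (use assms(1) True in \<open>auto simp: vtx_def\<close>)
  then show ?thesis by simp
next
  case False
  then have m: "j - (K - 1) \<in> {1..K}" "K - 1 + (j - (K - 1)) = j" using assms(2) by auto
  show ?thesis using assms(1)[OF m(1)] unfolding vtx_def m(2) by simp
qed

section \<open>The uniform distribution in vertex coordinates\<close>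

lemma finite_bitstrings [simp]: "finite (bitstrings m)"
proof -
  have "bitstrings m \<subseteq> PiE_dflt {..<m} False (\<lambda>_. UNIV)"
    by (auto simp: bitstrings_def PiE_dflt_def not_less)
  then show ?thesis by (rule finite_subset) auto
qed

lemma set_Pi_pmf_bitstrings: "set_pmf (Pi_pmf {..<m} False p) \<subseteq> bitstrings m"
  using set_Pi_pmf_subset[of "{..<m}" False p] by (auto simp: bitstrings_def)

lemma pmf_unif_bits: "pmf (unif_bits m) z = (if z \<in> bitstrings m then (1/2) ^ m else 0)"
proof -
  have "pmf (bernoulli_pmf (1/2)) v = 1/2" for v :: bool by (cases v) auto
  then show ?thesis unfolding unif_bits_def by (subst pmf_Pi) (auto simp: bitstrings_def)
qed

text \<open>The change of coordinates from (d, x) to (h, x), with h_m stored at position m - 1 in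
  place of d_m. It maps a finite set into itself, so injectivity suffices for it to preserve the
  uniform distribution.\<close>

definition vtx_code :: "nat \<Rightarrow> (nat \<Rightarrow> bool) \<Rightarrow> nat \<Rightarrow> bool" where
  "vtx_code K z j = (if j < K then fst (vtx K z (Suc j)) else z j)"

lemma vtx_code_eq:
  assumes "m \<in> {1..K}"
  shows "vtx_code K z (m - 1) = fst (vtx K z m)" "vtx_code K z (K - 1 + m) = snd (vtx K z m)"
proof -
  have "m - 1 < K" "Suc (m - 1) = m" "\<not> K - 1 + m < K" using assms by auto
  then show "vtx_code K z (m - 1) = fst (vtx K z m)" "vtx_code K z (K - 1 + m) = snd (vtx K z m)"
    unfolding vtx_code_def vtx_def by auto
qed

lemma bij_vtx_code: "bij_betw (vtx_code K) (bitstrings (2 * K)) (bitstrings (2 * K))"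
proof -
  have inj: "inj_on (vtx_code K) (bitstrings (2 * K))"
  proof (rule inj_onI)
    fix z z' assume z: "z \<in> bitstrings (2 * K)" "z' \<in> bitstrings (2 * K)"
      and eq: "vtx_code K z = vtx_code K z'"
    have v: "vtx K z m = vtx K z' m" if "m \<in> {1..K}" for m
      using vtx_code_eq[OF that, of z] vtx_code_eq[OF that, of z'] eq by (simp add: prod_eq_iff)
    show "z = z'"
    proof
      fix j show "z j = z' j"
        using vtx_determines_bits[OF v, of j] z by (cases "j < 2 * K") (auto simp: bitstrings_def)
    qed
  qed
  moreover have "vtx_code K ` bitstrings (2 * K) \<subseteq> bitstrings (2 * K)"
    by (auto simp: vtx_code_def bitstrings_def)
  ultimately show ?thesis
    by (simp add: bij_betw_def endo_inj_surj)
qed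

lemma map_vtx_code_unif: "map_pmf (vtx_code K) (unif_bits (2 * K)) = unif_bits (2 * K)"
proof -
  have eq: "unif_bits (2 * K) = pmf_of_set (bitstrings (2 * K))"
  proof -
    have "bernoulli_pmf (1/2) = pmf_of_set UNIV" by (rule bernoulli_pmf_half_conv_pmf_of_set)
    then have "unif_bits (2 * K) = pmf_of_set (PiE_dflt {..<2 * K} False (\<lambda>_. UNIV))"
      unfolding unif_bits_def by (simp add: Pi_pmf_of_set)
    also have "PiE_dflt {..<2 * K} False (\<lambda>_. UNIV) = bitstrings (2 * K)"
      by (auto simp: bitstrings_def PiE_dflt_def not_less)
    finally show ?thesis .
  qed
  have "(\<lambda>_. False) \<in> bitstrings (2 * K)" by (auto simp: bitstrings_def)
  then show ?thesis unfolding eq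
    by (intro map_pmf_of_set_bij_betw bij_vtx_code) auto
qed

definition special :: "nat \<Rightarrow> nat set \<Rightarrow> (nat \<Rightarrow> bool) \<Rightarrow> bool" where
  "special K V z \<longleftrightarrow> (\<forall>m\<in>V. vtx K z m = (False, True))"

text \<open>In the coordinates of \<open>vtx_code\<close>, being special fixes two independent fair
  bits for each vertex.\<close>

lemma prob_special:
  assumes "V \<subseteq> {1..K}"
  shows "measure_pmf.prob (unif_bits (2 * K)) {z. special K V z} = (1/4) ^ card V"
proof -
  define C where "C = (\<lambda>m. m - 1) ` V \<union> (\<lambda>m. K - 1 + m) ` V"
  \<comment> \<open>The prescribed value is 0 at a label position (below K) and 1 at an x
    position.\<close>
  define B where "B j = (if j \<in> C then {\<not> j < K} else UNIV)" for j
  have fin: "finite V" using assms finite_subset by blast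
  have C: "C \<subseteq> {..<2 * K}"
  proof
    fix j assume "j \<in> C"
    then obtain m where "m \<in> V" and j: "j = m - 1 \<or> j = K - 1 + m" unfolding C_def by blast
    then have "m \<in> {1..K}" using assms by blast
    then show "j \<in> {..<2 * K}" using j by auto
  qed
  have cC: "card C = 2 * card V"
  proof -
    have "a - 1 \<noteq> K - 1 + b" if "a \<in> V" "b \<in> V" for a b
    proof -
      have "a \<in> {1..K}" "b \<in> {1..K}" using that assms by blast+
      then show ?thesis by auto
    qed
    then have "(\<lambda>m. m - 1) ` V \<inter> (\<lambda>m. K - 1 + m) ` V = {}" by blast
    moreover have "inj_on (\<lambda>m. m - 1) V"
      using assms by (intro inj_on_diff_nat) auto
    ultimately show ?thesis unfolding C_def using fin
      by (subst card_Un_disjoint) (auto simp: card_image)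
  qed
  have "{z. special K V z} = vtx_code K -` Pi {..<2 * K} B"
  proof -
    have "special K V z \<longleftrightarrow> vtx_code K z \<in> Pi {..<2 * K} B" for z
    proof -
      have "vtx_code K z \<in> Pi {..<2 * K} B \<longleftrightarrow> (\<forall>j\<in>C. vtx_code K z j = (\<not> j < K))"
        using C by (auto simp: B_def Pi_def split: if_splits)
      also have "\<dots> \<longleftrightarrow> (\<forall>m\<in>V. vtx_code K z (m - 1) = (\<not> m - 1 < K) \<and>
            vtx_code K z (K - 1 + m) = (\<not> K - 1 + m < K))"
        by (auto simp: C_def)
      also have "\<dots> \<longleftrightarrow> special K V z"
      proof -
        have "(vtx_code K z (m - 1) = (\<not> m - 1 < K) \<and>
            vtx_code K z (K - 1 + m) = (\<not> K - 1 + m < K)) = (vtx K z m = (False, True))"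
          if "m \<in> V" for m
        proof -
          have "m \<in> {1..K}" using that assms by auto
          then have "m - 1 < K" "\<not> K - 1 + m < K" by auto
          then show ?thesis using vtx_code_eq[OF \<open>m \<in> {1..K}\<close>, of z] by (simp add: prod_eq_iff)
        qed
        then show ?thesis unfolding special_def by auto
      qed
      finally show ?thesis ..
    qed
    then show ?thesis by auto
  qed
  then have "measure_pmf.prob (unif_bits (2 * K)) {z. special K V z} =
      measure_pmf.prob (map_pmf (vtx_code K) (unif_bits (2 * K))) (Pi {..<2 * K} B)"
    by simp
  also have "\<dots> = (\<Prod>j<2 * K. measure_pmf.prob (bernoulli_pmf (1/2)) (B j))"
    unfolding map_vtx_code_unif unfolding unif_bits_def by (rule measure_Pi_pmf_Pi) simp
  also have "\<dots> = (\<Prod>j<2 * K. if j \<in> C then 1/2 else 1)"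
  proof (rule prod.cong)
    fix j
    have "measure_pmf.prob (bernoulli_pmf (1/2)) {v} = 1/2" for v :: bool
      by (cases v) (simp_all add: measure_pmf_single)
    then show "measure_pmf.prob (bernoulli_pmf (1/2)) (B j) = (if j \<in> C then 1/2 else 1)"
      by (simp add: B_def)
  qed simp
  also have "\<dots> = (\<Prod>j\<in>C. 1/2)"
    using C by (intro prod.mono_neutral_cong_right) auto
  also have "\<dots> = (1/4) ^ card V" by (simp add: cC power_mult power2_eq_square power_divide)
  finally show ?thesis .
qed

section \<open>Expectations over products of finitely supported distributions\<close>

lemma expectation_pair_pmf_finite:
  fixes h :: "'a \<times> 'b \<Rightarrow> 'c::{banach, second_countable_topology}"
  assumes "finite (set_pmf P)" "finite (set_pmf Q)"
  shows "measure_pmf.expectation (pair_pmf P Q) h =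
    measure_pmf.expectation P (\<lambda>a. measure_pmf.expectation Q (\<lambda>b. h (a, b)))"
proof -
  have "pair_pmf P Q = bind_pmf P (\<lambda>a. map_pmf (Pair a) Q)"
    by (simp add: pair_pmf_def map_pmf_def)
  then have "measure_pmf.expectation (pair_pmf P Q) h =
      (\<Sum>a\<in>set_pmf P. pmf P a *\<^sub>R measure_pmf.expectation (map_pmf (Pair a) Q) h)"
    using assms by (simp add: pmf_expectation_bind[of "set_pmf P"])
  also have "\<dots> = measure_pmf.expectation P (\<lambda>a. measure_pmf.expectation Q (\<lambda>b. h (a, b)))"
    using assms by (subst integral_measure_pmf[of "set_pmf P"]) auto
  finally show ?thesis .
qed

lemma finite_set_Pi_pmf:
  assumes "finite A" "\<And>x. x \<in> A \<Longrightarrow> finite (set_pmf (p x))"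
  shows "finite (set_pmf (Pi_pmf A dflt p))"
  using assms by (auto simp: set_Pi_pmf)

text \<open>The value type is a general normed field because the lemma serves complex characters as
  well as real inverse weights.\<close>

lemma expectation_prod_Pi_pmf_finite:
  fixes f :: "'a \<Rightarrow> 'b \<Rightarrow> 'c::{real_normed_field, banach, second_countable_topology}"
  assumes "finite A" "\<And>x. x \<in> A \<Longrightarrow> finite (set_pmf (p x))"
  shows "measure_pmf.expectation (Pi_pmf A dflt p) (\<lambda>y. \<Prod>x\<in>A. f x (y x)) =
    (\<Prod>x\<in>A. measure_pmf.expectation (p x) (f x))"
  using assms
proof (induction A rule: finite_induct)
  case (insert a A)
  have "measure_pmf.expectation (Pi_pmf (insert a A) dflt p) (\<lambda>y. \<Prod>x\<in>insert a A. f x (y x)) =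
      measure_pmf.expectation (pair_pmf (p a) (Pi_pmf A dflt p))
        (\<lambda>vy. \<Prod>x\<in>insert a A. f x (((snd vy)(a := fst vy)) x))"
    using insert by (subst Pi_pmf_insert) (auto simp: case_prod_unfold)
  also have "\<dots> = measure_pmf.expectation (p a) (\<lambda>v. measure_pmf.expectation (Pi_pmf A dflt p)
        (\<lambda>y. \<Prod>x\<in>insert a A. f x ((y(a := v)) x)))"
    using insert by (subst expectation_pair_pmf_finite) (auto intro!: finite_set_Pi_pmf)
  also have "\<dots> = measure_pmf.expectation (p a) (\<lambda>v. measure_pmf.expectation (Pi_pmf A dflt p)
        (\<lambda>y. f a v * (\<Prod>x\<in>A. f x (y x))))"
  proof -
    have "(\<Prod>x\<in>insert a A. f x ((y(a := v)) x)) = f a v * (\<Prod>x\<in>A. f x (y x))" for v y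
      using insert by (auto intro!: prod.cong)
    then show ?thesis by simp
  qed
  also have "\<dots> = measure_pmf.expectation (p a) (f a) * (\<Prod>x\<in>A. measure_pmf.expectation (p x) (f x))"
    using insert by simp
  finally show ?case using insert by simp
qed simp

section \<open>Bias of the last bit\<close>

text \<open>Orthogonality of the characters of Z/p: a geometric sum over the powers of a p-th root
  of unity other than 1 vanishes.\<close>

lemma sum_cis_multiples:
  fixes m :: int
  assumes "p > 0"
  shows "(\<Sum>a<p. cis (2 * pi * real a * real_of_int m / real p)) = (if int p dvd m then of_nat p else 0)"
proof (cases "int p dvd m")
  case True
  then obtain c where c: "m = int p * c" by blast
  have "cis (2 * pi * real a * real_of_int m / real p) = 1" for a
  proof -
    have "2 * pi * real a * real_of_int m / real p = 2 * pi * of_int (int a * c)"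
      using assms by (simp add: c)
    then show ?thesis by (simp only: cis_multiple_2pi Ints_of_int)
  qed
  then show ?thesis using True by simp
next
  case False
  define w where "w = cis (2 * pi * real_of_int m / real p)"
  have pow: "w ^ a = cis (2 * pi * real a * real_of_int m / real p)" for a
    unfolding w_def Complex.DeMoivre by (rule arg_cong[of _ _ cis]) simp
  have "w ^ p = cis (2 * pi * real p * real_of_int m / real p)" by (rule pow)
  also have "2 * pi * real p * real_of_int m / real p = 2 * pi * real_of_int m" using assms by simp
  finally have "w ^ p = 1" by (simp only: cis_multiple_2pi Ints_of_int)
  moreover have "w \<noteq> 1"
  proof
    assume "w = 1"
    then have "cos (2 * pi * real_of_int m / real p) = 1" unfolding w_def by (metis cis.sel(1) one_complex.sel(1))
    then obtain k :: int where "2 * pi * real_of_int m / real p = real_of_int k * 2 * pi"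
      using cos_one_2pi_int by blast
    then have "real_of_int m = real_of_int (k * int p)" using assms by (simp add: field_simps)
    then have "m = k * int p" by (simp only: of_int_eq_iff)
    then show False using False by simp
  qed
  ultimately have "(\<Sum>a<p. w ^ a) = 0" by (simp add: geometric_sum)
  then show ?thesis using False by (simp add: pow)
qed

lemma abs_sin_multiple_le: "\<bar>sin (real n * y)\<bar> \<le> real n * \<bar>sin y\<bar>"
proof (induction n)
  case (Suc n)
  have "sin (real (Suc n) * y) = sin (real n * y) * cos y + cos (real n * y) * sin y"
    by (simp add: sin_add distrib_right add.commute)
  also have "\<bar>\<dots>\<bar> \<le> \<bar>sin (real n * y)\<bar> * 1 + 1 * \<bar>sin y\<bar>"
    by (intro order_trans[OF abs_triangle_ineq] add_mono) (auto simp: abs_mult mult_left_le mult_left_le_one_le)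
  finally show ?case using Suc by (simp add: algebra_simps)
qed simp

text \<open>Angles are multiples of \<pi>/p rather than 2\<pi>/p, to make room for half turns coming
  from signs. Such an angle, if p does not divide j, stays \<pi>/p away from all multiples of
  2\<pi>. Finally cos(\<pi>/p) = 1 - 2 sin^2(\<pi>/(2p)), and \<open>abs_sin_multiple_le\<close>
  with n = p gives sin(\<pi>/(2p)) \<ge> 1/p.\<close>

lemma cos_rational_le:
  fixes j :: int
  assumes "p > 0" "\<not> int p dvd j"
  shows "cos (pi * real_of_int j / real p) \<le> 1 - 2 / (real p)\<^sup>2"
proof -
  define j' where "j' = j mod (2 * int p)"
  have "j' \<noteq> 0" using assms unfolding j'_def by (metis dvd_eq_mod_eq_0 dvd_mult_right)
  moreover have "0 \<le> j'" "j' < 2 * int p" using assms by (auto simp: j'_def)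
  ultimately have j': "1 \<le> j'" "j' \<le> 2 * int p - 1" by auto
  define x where "x = pi * real_of_int j' / real p"
  have "j = j' + 2 * int p * (j div (2 * int p))" by (simp add: j'_def)
  then have "real_of_int j = real_of_int (j' + 2 * int p * (j div (2 * int p)))" by (rule arg_cong)
  then have jr: "real_of_int j = real_of_int j' + 2 * real p * real_of_int (j div (2 * int p))" by simp
  have "pi * real_of_int j / real p = x + 2 * pi * real_of_int (j div (2 * int p))"
    using assms unfolding x_def jr by (simp add: distrib_left add_divide_distrib)
  then have c1: "cos (pi * real_of_int j / real p) = cos x"
    by (simp only: cos_add cos_int_2pin sin_int_2pin)
  have lo: "pi / real p \<le> x"
    using j'(1) by (simp add: x_def divide_right_mono)
  have "real_of_int j' \<le> 2 * real p - 1" using j'(2) by linarith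
  then have "x \<le> pi * (2 * real p - 1) / real p"
    unfolding x_def by (intro divide_right_mono mult_left_mono) auto
  also have "\<dots> = 2 * pi - pi / real p" using assms by (simp add: field_simps)
  finally have hi: "x \<le> 2 * pi - pi / real p" .
  have pp: "0 \<le> pi / real p" "pi / real p \<le> pi" using assms by (auto simp: field_simps)
  have "cos x \<le> cos (pi / real p)"
  proof (cases "x \<le> pi")
    case True then show ?thesis using lo pp by (intro cos_monotone_0_pi_le) auto
  next
    case False
    have "cos x = cos (2 * pi - x)" by simp
    also have "\<dots> \<le> cos (pi / real p)" using False hi pp by (intro cos_monotone_0_pi_le) auto
    finally show ?thesis .
  qed
  also have "cos (pi / real p) = 1 - 2 * (sin (pi / real p / 2))\<^sup>2"
    using cos_double_sin[of "pi / real p / 2"] by simp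
  also have "\<dots> \<le> 1 - 2 * (1 / real p)\<^sup>2"
  proof -
    have "1 = \<bar>sin (real p * (pi / real p / 2))\<bar>" using assms by simp
    also have "\<dots> \<le> real p * \<bar>sin (pi / real p / 2)\<bar>" by (rule abs_sin_multiple_le)
    finally have "1 / real p \<le> \<bar>sin (pi / real p / 2)\<bar>" using assms by (simp add: field_simps)
    then have "(1 / real p)\<^sup>2 \<le> \<bar>sin (pi / real p / 2)\<bar>\<^sup>2" by (intro power_mono) auto
    then show ?thesis by simp
  qed
  finally show ?thesis using c1 by (simp add: power_divide)
qed

text \<open>Up to a rotation this is |q e^(ix) + 1 - q|, whose square equals 1 - 2 q (1 - q) (1 -
  cos x).\<close>

lemma norm_two_point_le:
  assumes "0 \<le> q" "q \<le> 1" "cos x \<le> 1 - c"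
  shows "norm (of_real q * cis (a + x) + of_real (1 - q) * cis a) \<le> sqrt (1 - 2 * q * (1 - q) * c)"
proof -
  have "of_real q * cis (a + x) + of_real (1 - q) * cis a =
      cis a * (of_real q * cis x + of_real (1 - q))"
    by (simp add: cis_mult[symmetric] algebra_simps)
  then have "norm (of_real q * cis (a + x) + of_real (1 - q) * cis a) =
      norm (of_real q * cis x + of_real (1 - q))"
    by (simp only: norm_mult norm_cis mult_1)
  also have "\<dots> = sqrt ((q * cos x + (1 - q))\<^sup>2 + (q * sin x)\<^sup>2)"
    by (simp add: norm_complex_def)
  also have "(q * cos x + (1 - q))\<^sup>2 + (q * sin x)\<^sup>2 =
      q\<^sup>2 * ((cos x)\<^sup>2 + (sin x)\<^sup>2) + 2 * q * (1 - q) * cos x + (1 - q)\<^sup>2"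
    by algebra
  also have "\<dots> = 1 - 2 * q * (1 - q) * (1 - cos x)"
    by (simp add: power2_eq_square algebra_simps)
  also have "\<dots> \<le> 1 - 2 * q * (1 - q) * c"
    using assms by (intro diff_left_mono mult_left_mono) auto
  finally show ?thesis by simp
qed

lemma sum_sgnb_MM:
  assumes "odd p"
  shows "(\<Sum>t<p. sgnb (MM (int p) (int t))) = 1"
proof -
  obtain h where p: "p = 2 * h + 1" using assms by (auto elim: oddE)
  have "MM (int p) (int t) \<longleftrightarrow> \<not> t \<le> h" if "t < p" for t
    using that by (simp add: MM_def p)
  then have "(\<Sum>t<p. sgnb (MM (int p) (int t))) = (\<Sum>t<p. if t \<le> h then 1 else - 1)"
    by (intro sum.cong) (auto simp: sgnb_def)
  also have "\<dots> = (\<Sum>t\<in>{..h} \<union> {h+1..<p}. if t \<le> h then 1 else - 1)"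
    by (intro sum.cong) (auto simp: p)
  also have "\<dots> = (\<Sum>t\<in>{..h}. 1) + (\<Sum>t\<in>{h+1..<p}. - 1)"
    by (subst sum.union_disjoint) (auto intro!: arg_cong2[of _ _ _ _ "(+)"] sum.cong)
  also have "\<dots> = 1" by (simp add: p)
  finally show ?thesis .
qed

text \<open>\<open>sqrt\<close> of a negative real is negative, so the sign of the radicand has to
  be known before powers of the root can be compared.\<close>

lemma damping_nonneg:
  fixes q :: real
  assumes "p > 0"
  shows "0 \<le> 1 - 4 * q * (1 - q) / (real p)\<^sup>2"
proof -
  have "4 * q * (1 - q) \<le> 1"
    using zero_le_power2[of "2 * q - 1"] by (simp add: power2_eq_square algebra_simps)
  moreover have "1 \<le> (real p)\<^sup>2" using assms by (simp add: one_le_power)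
  ultimately have "4 * q * (1 - q) \<le> (real p)\<^sup>2" by linarith
  then show ?thesis using assms by (simp add: divide_le_eq)
qed

text \<open>Fourier expansion on \<open>\<int>/p\<close>: the trivial character contributes \<open>1/p\<close>, because the two classes of
  \<open>MM\<close> differ in size by one, and every other character is damped by each block whose weight
  varies modulo \<open>p\<close>; since \<open>p\<close> is odd, a sign change cannot undo the damping.\<close>
lemma MM_parity_bias:
  fixes A :: "nat \<Rightarrow> bool \<Rightarrow> int" and e :: "nat \<Rightarrow> bool \<Rightarrow> real"
  assumes p: "prime p" "p > 2" and q: "0 \<le> q" "q \<le> 1" and I: "finite I" "G \<subseteq> I"
    and e: "\<And>i v. e i v \<in> {-1, 1}"
    and G: "\<And>i. i \<in> G \<Longrightarrow> \<not> int p dvd A i True - A i False"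
  shows "\<bar>measure_pmf.expectation (Pi_pmf I False (\<lambda>_. bernoulli_pmf q))
      (\<lambda>x. sgnb (MM (int p) (a0 + (\<Sum>i\<in>I. A i (x i)))) * (\<Prod>i\<in>I. e i (x i)))\<bar>
    \<le> 1 / real p + real p * sqrt (1 - 4 * q * (1 - q) / (real p)\<^sup>2) ^ card G"
proof -
  define \<rho> where "\<rho> = sqrt (1 - 4 * q * (1 - q) / (real p)\<^sup>2)"
  define D where "D = Pi_pmf I False (\<lambda>_. bernoulli_pmf q)"
  define s where "s x = a0 + (\<Sum>i\<in>I. A i (x i))" for x
  define F where "F a i v = cis (2 * pi * real a * real_of_int (A i v) / real p) * of_real (e i v)"
    for a i v
  define \<Psi> where "\<Psi> a = measure_pmf.expectation D (\<lambda>x. cis (2 * pi * real a * real_of_int (s x) / real p) *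
      of_real (\<Prod>i\<in>I. e i (x i)))" for a
  have p0: "p > 0" using p by simp
  have fin: "finite (set_pmf D)" unfolding D_def using I by (intro finite_set_Pi_pmf) auto
  have int: "integrable (measure_pmf D) g" for g :: "_ \<Rightarrow> complex"
    by (rule integrable_measure_pmf_finite[OF fin])
  have ne: "norm (e i v) = 1" for i v using e[of i v] by auto
  have nF: "norm (measure_pmf.expectation (bernoulli_pmf q) (F a i)) \<le> 1" for a i
  proof -
    have "norm (measure_pmf.expectation (bernoulli_pmf q) (F a i)) \<le>
        measure_pmf.expectation (bernoulli_pmf q) (\<lambda>v. norm (F a i v))" by (rule integral_norm_bound)
    also have "\<dots> = 1" by (simp add: F_def norm_mult ne[unfolded real_norm_def])
    finally show ?thesis .
  qed
  have \<rho>1: "0 \<le> \<rho>" using damping_nonneg[OF p0] by (simp add: \<rho>_def)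
  have nFG: "norm (measure_pmf.expectation (bernoulli_pmf q) (F a i)) \<le> \<rho>"
    if "i \<in> G" "0 < a" "a < p" for a i
  proof -
    \<comment> \<open>The sign is absorbed as a half turn. The two values of \<open>F a i\<close>
      then differ by the angle \<pi> j / p, where j is congruent to 2 a (A i True - A i False)
      modulo p because the sign contributes a multiple of p.\<close>
    define \<kappa> where "\<kappa> v = (if e i v = 1 then 0 else 1 :: int)" for v
    define j where "j = 2 * int a * (A i True - A i False) + (\<kappa> True - \<kappa> False) * int p"
    define x where "x = pi * real_of_int j / real p"
    define b where "b v = 2 * pi * real a * real_of_int (A i v) / real p + pi * real_of_int (\<kappa> v)" for v
    have F: "F a i v = cis (b v)" for v
    proof -
      have "of_real (e i v) = cis (pi * real_of_int (\<kappa> v))" using e[of i v] by (auto simp: \<kappa>_def)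
      then show ?thesis by (simp add: F_def b_def cis_mult)
    qed
    have bx: "b True = b False + x"
      using p0 by (simp add: b_def x_def j_def field_simps)
    have "\<not> int p dvd j"
    proof
      assume "int p dvd j"
      then have "int p dvd 2 * int a * (A i True - A i False)"
        unfolding j_def by (metis dvd_add_left_iff dvd_triv_right)
      then have "int p dvd 2 \<or> int p dvd int a \<or> int p dvd A i True - A i False"
        using p(1) by (simp add: prime_dvd_mult_iff)
      moreover have "\<not> int p dvd 2" using p by (auto dest: zdvd_imp_le)
      moreover have "\<not> int p dvd int a" using that by (auto dest: zdvd_imp_le)
      ultimately show False using G[OF that(1)] by blast
    qed
    then have "cos x \<le> 1 - 2 / (real p)\<^sup>2" unfolding x_def by (rule cos_rational_le[OF p0])
    then have "norm (of_real q * cis (b False + x) + of_real (1 - q) * cis (b False))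
        \<le> sqrt (1 - 2 * q * (1 - q) * (2 / (real p)\<^sup>2))"
      by (rule norm_two_point_le[OF q])
    moreover have "measure_pmf.expectation (bernoulli_pmf q) (F a i) =
        of_real q * cis (b False + x) + of_real (1 - q) * cis (b False)"
      using q by (subst integral_measure_pmf[of UNIV]) (auto simp: UNIV_bool F bx scaleR_conv_of_real)
    moreover have "2 * q * (1 - q) * (2 / (real p)\<^sup>2) = 4 * q * (1 - q) / (real p)\<^sup>2" by simp
    ultimately show ?thesis unfolding \<rho>_def by metis
  qed
  have \<Psi>: "\<Psi> a = cis (2 * pi * real a * real_of_int a0 / real p) *
      (\<Prod>i\<in>I. measure_pmf.expectation (bernoulli_pmf q) (F a i))" for a
  proof -
    have "cis (2 * pi * real a * real_of_int (s x) / real p) * of_real (\<Prod>i\<in>I. e i (x i)) =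
        cis (2 * pi * real a * real_of_int a0 / real p) * (\<Prod>i\<in>I. F a i (x i))" for x
    proof -
      have "cis (\<Sum>i\<in>J. g i) = (\<Prod>i\<in>J. cis (g i))" if "finite J" for J and g :: "nat \<Rightarrow> real"
        using that by (induction J rule: finite_induct) (auto simp: cis_mult[symmetric])
      note c = this[OF I(1)]
      have "2 * pi * real a * real_of_int (s x) / real p = 2 * pi * real a * real_of_int a0 / real p
          + (\<Sum>i\<in>I. 2 * pi * real a * real_of_int (A i (x i)) / real p)"
        by (simp add: s_def distrib_left add_divide_distrib sum_distrib_left sum_divide_distrib)
      then show ?thesis by (simp add: cis_mult[symmetric] c F_def prod.distrib)
    qed
    then have "\<Psi> a = cis (2 * pi * real a * real_of_int a0 / real p) *
        measure_pmf.expectation D (\<lambda>x. \<Prod>i\<in>I. F a i (x i))"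
      by (simp add: \<Psi>_def)
    also have "measure_pmf.expectation D (\<lambda>x. \<Prod>i\<in>I. F a i (x i)) =
        (\<Prod>i\<in>I. measure_pmf.expectation (bernoulli_pmf q) (F a i))"
      unfolding D_def using I by (intro expectation_prod_Pi_pmf_finite) auto
    finally show ?thesis .
  qed
  have \<Psi>0: "norm (\<Psi> 0) \<le> 1"
    unfolding \<Psi> norm_mult norm_cis prod_norm[symmetric] by (simp add: prod_le_1 nF)
  have \<Psi>a: "norm (\<Psi> a) \<le> \<rho> ^ card G" if "0 < a" "a < p" for a
  proof -
    have "norm (\<Psi> a) = (\<Prod>i\<in>I. norm (measure_pmf.expectation (bernoulli_pmf q) (F a i)))"
      unfolding \<Psi> norm_mult norm_cis prod_norm[symmetric] by simp
    also have "\<dots> \<le> (\<Prod>i\<in>I. if i \<in> G then \<rho> else 1)"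
      using nF nFG that by (intro prod_mono) auto
    also have "\<dots> = (\<Prod>i\<in>G. \<rho>)"
      using I by (intro prod.mono_neutral_cong_right) auto
    finally show ?thesis by simp
  qed
  define g where "g t = sgnb (MM (int p) (int t))" for t
  have ng: "\<bar>g t\<bar> = 1" for t by (simp add: g_def sgnb_def)
  \<comment> \<open>Fourier inversion for the function \<open>sgnb\<close> of \<open>MM\<close> on
    Z/p.\<close>
  have expand: "complex_of_real (sgnb (MM (int p) u)) = (\<Sum>t<p. \<Sum>a<p. of_real (g t / real p) *
      cis (2 * pi * real a * real_of_int (- int t) / real p) *
      cis (2 * pi * real a * real_of_int u / real p))" for u
  proof -
    define t0 where "t0 = nat (u mod int p)"
    have t0: "t0 < p" "int t0 = u mod int p" using p0 by (auto simp: t0_def nat_less_iff)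
    have "(\<Sum>t<p. \<Sum>a<p. of_real (g t / real p) *
        cis (2 * pi * real a * real_of_int (- int t) / real p) *
        cis (2 * pi * real a * real_of_int u / real p)) =
      (\<Sum>t<p. of_real (g t / real p) * (\<Sum>a<p. cis (2 * pi * real a * real_of_int (u - int t) / real p)))"
    proof -
      have "cis (2 * pi * real a * real_of_int (- int t) / real p) *
          cis (2 * pi * real a * real_of_int u / real p) =
          cis (2 * pi * real a * real_of_int (u - int t) / real p)" for a t
        unfolding cis_mult
        by (rule arg_cong[of _ _ cis]) (simp add: right_diff_distrib diff_divide_distrib)
      then show ?thesis unfolding sum_distrib_left mult.assoc by simp
    qed
    also have "\<dots> = (\<Sum>t<p. if t = t0 then of_real (g t) else 0)"
    proof (rule sum.cong)
      fix t assume "t \<in> {..<p}"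
      then have "int p dvd u - int t \<longleftrightarrow> t = t0"
        using t0 by (auto simp: mod_eq_dvd_iff[symmetric])
      then show "of_real (g t / real p) * (\<Sum>a<p. cis (2 * pi * real a * real_of_int (u - int t) / real p)) =
          (if t = t0 then of_real (g t) else 0)"
        unfolding sum_cis_multiples[OF p0] using p0 by simp
    qed simp
    also have "\<dots> = of_real (g t0)" using t0 by simp
    also have "g t0 = sgnb (MM (int p) u)"
      unfolding g_def t0(2) by (simp add: MM_def)
    finally show ?thesis ..
  qed
  define \<theta> where "\<theta> a t = of_real (g t / real p) * cis (2 * pi * real a * real_of_int (- int t) / real p)"
    for a t
  have n\<theta>: "norm (\<theta> a t) = 1 / real p" for a t
    by (simp add: \<theta>_def norm_mult ng norm_divide)
  have "complex_of_real (measure_pmf.expectation D (\<lambda>x. sgnb (MM (int p) (s x)) * (\<Prod>i\<in>I. e i (x i)))) =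
      measure_pmf.expectation D (\<lambda>x. \<Sum>t<p. \<Sum>a<p. \<theta> a t *
        (cis (2 * pi * real a * real_of_int (s x) / real p) * of_real (\<Prod>i\<in>I. e i (x i))))"
    unfolding integral_complex_of_real[symmetric] of_real_mult expand \<theta>_def[symmetric]
    by (simp add: sum_distrib_right mult.assoc)
  also have "\<dots> = (\<Sum>t<p. \<Sum>a<p. \<theta> a t * \<Psi> a)"
    by (simp add: \<Psi>_def int)
  also have "\<dots> = (\<Sum>a<p. (\<Sum>t<p. \<theta> a t) * \<Psi> a)"
    by (subst sum.swap) (simp add: sum_distrib_right)
  also have "\<dots> = (\<Sum>t<p. \<theta> 0 t) * \<Psi> 0 + (\<Sum>a\<in>{0<..<p}. (\<Sum>t<p. \<theta> a t) * \<Psi> a)"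
  proof -
    have "{..<p} = insert 0 {0<..<p}" using p0 by auto
    then show ?thesis by simp
  qed
  finally have E: "complex_of_real (measure_pmf.expectation D (\<lambda>x. sgnb (MM (int p) (s x)) * (\<Prod>i\<in>I. e i (x i)))) =
      (\<Sum>t<p. \<theta> 0 t) * \<Psi> 0 + (\<Sum>a\<in>{0<..<p}. (\<Sum>t<p. \<theta> a t) * \<Psi> a)" .
  have "(\<Sum>t<p. \<theta> 0 t) = of_real ((\<Sum>t<p. g t) / real p)"
    by (simp add: \<theta>_def sum_divide_distrib)
  also have "(\<Sum>t<p. g t) = 1" unfolding g_def
    by (rule sum_sgnb_MM) (use p prime_odd_nat in auto)
  finally have "norm ((\<Sum>t<p. \<theta> 0 t) * \<Psi> 0) \<le> 1 / real p"
    using \<Psi>0 by (simp add: norm_mult norm_divide divide_right_mono)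
  moreover have "norm (\<Sum>a\<in>{0<..<p}. (\<Sum>t<p. \<theta> a t) * \<Psi> a) \<le> (\<Sum>a\<in>{0<..<p}. \<rho> ^ card G)"
  proof (rule sum_norm_le)
    fix a assume a: "a \<in> {0<..<p}"
    \<comment> \<open>The trivial bound 1 on every Fourier coefficient is enough: summation over the
      frequencies only costs the factor p in the claim.\<close>
    have "norm (\<Sum>t<p. \<theta> a t) \<le> (\<Sum>t<p. 1 / real p)" by (rule sum_norm_le) (simp add: n\<theta>)
    then have "norm (\<Sum>t<p. \<theta> a t) \<le> 1" using p0 by simp
    then show "norm ((\<Sum>t<p. \<theta> a t) * \<Psi> a) \<le> \<rho> ^ card G"
      unfolding norm_mult using mult_mono[OF _ \<Psi>a, of "norm (\<Sum>t<p. \<theta> a t)" 1 a] a by simp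
  qed
  moreover have "(\<Sum>a\<in>{0<..<p}. \<rho> ^ card G) \<le> real p * \<rho> ^ card G"
    using \<rho>1 by (auto intro!: mult_right_mono)
  ultimately have "norm (complex_of_real (measure_pmf.expectation D
      (\<lambda>x. sgnb (MM (int p) (s x)) * (\<Prod>i\<in>I. e i (x i))))) \<le> 1 / real p + real p * \<rho> ^ card G"
    unfolding E by (intro order_trans[OF norm_triangle_ineq]) linarith
  then show ?thesis unfolding norm_of_real D_def s_def \<rho>_def .
qed

lemma expectation_Pi_pmf_split:
  fixes h :: "('a \<Rightarrow> 'b) \<Rightarrow> 'c::{banach, second_countable_topology}"
  assumes "finite A" "I \<subseteq> A" "\<And>x. x \<in> A \<Longrightarrow> finite (set_pmf (p x))"
  shows "measure_pmf.expectation (Pi_pmf A dflt p) h =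
    measure_pmf.expectation (Pi_pmf (A - I) dflt p) (\<lambda>y.
      measure_pmf.expectation (Pi_pmf I dflt p) (\<lambda>x. h (\<lambda>i. if i \<in> I then x i else y i)))"
proof -
  have fin: "finite I" "finite (A - I)" and A: "A = I \<union> (A - I)"
    using assms finite_subset by auto
  have "Pi_pmf A dflt p = map_pmf (\<lambda>(f, g) x. if x \<in> I then f x else g x)
      (pair_pmf (Pi_pmf I dflt p) (Pi_pmf (A - I) dflt p))"
    by (subst A, rule Pi_pmf_union) (use fin in auto)
  also have "\<dots> = map_pmf (\<lambda>(g, f) x. if x \<in> I then f x else g x)
      (pair_pmf (Pi_pmf (A - I) dflt p) (Pi_pmf I dflt p))"
    by (subst pair_commute_pmf)
      (auto simp: map_pmf_comp intro!: map_pmf_cong)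
  finally have "measure_pmf.expectation (Pi_pmf A dflt p) h =
      measure_pmf.expectation (pair_pmf (Pi_pmf (A - I) dflt p) (Pi_pmf I dflt p))
        (\<lambda>gf. h (\<lambda>x. if x \<in> I then snd gf x else fst gf x))"
    by (simp add: case_prod_unfold)
  also have "\<dots> = measure_pmf.expectation (Pi_pmf (A - I) dflt p) (\<lambda>y.
      measure_pmf.expectation (Pi_pmf I dflt p) (\<lambda>x. h (\<lambda>i. if i \<in> I then x i else y i)))"
    using assms fin
    by (subst expectation_pair_pmf_finite) (auto intro!: finite_set_Pi_pmf cong: if_cong)
  finally show ?thesis .
qed

section \<open>Heavy outputs\<close>

lemma pmf_map_ge_cylinder:
  assumes "\<And>u'. u' \<in> bitstrings l \<Longrightarrow> (\<And>i. i \<in> {..<l} - F \<Longrightarrow> u' i = u i) \<Longrightarrow> g u' = g u"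
  shows "(\<Prod>i\<in>{..<l} - F. pmf B (u i)) \<le> pmf (map_pmf g (Pi_pmf {..<l} False (\<lambda>_. B))) (g u)"
proof -
  define C where "C i = (if i \<in> F then UNIV else {u i})" for i
  have "(\<Prod>i\<in>{..<l} - F. pmf B (u i)) = (\<Prod>i<l. measure_pmf.prob B (C i))"
    by (rule prod.mono_neutral_cong_left) (auto simp: C_def measure_pmf_single)
  also have "\<dots> = measure_pmf.prob (Pi_pmf {..<l} False (\<lambda>_. B)) (PiE_dflt {..<l} False C)"
    by (simp add: measure_Pi_pmf_PiE_dflt)
  also have "\<dots> \<le> measure_pmf.prob (Pi_pmf {..<l} False (\<lambda>_. B)) (g -` {g u})"
  proof (rule measure_pmf.finite_measure_mono)
    show "PiE_dflt {..<l} False C \<subseteq> g -` {g u}"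
    proof
      fix u' assume u': "u' \<in> PiE_dflt {..<l} False C"
      then have "g u' = g u"
        by (intro assms) (auto simp: PiE_dflt_def bitstrings_def C_def split: if_splits)
      then show "u' \<in> g -` {g u}" by simp
    qed
  qed simp
  finally show ?thesis by (simp add: pmf_map)
qed

text \<open>The output at \<open>u\<close> carries at least the mass of the cylinder of inputs that agree with \<open>u\<close> off
  \<open>F u\<close>; Markov's inequality for a small negative power of that mass replaces a typical-set argument.\<close>
lemma prob_light_output_le:
  assumes B: "\<And>v. pmf B v > 0" and c: "c > 0" and lam: "lam \<ge> 0"
    and inv: "\<And>u u'. u \<in> bitstrings l \<Longrightarrow> E u \<Longrightarrow> u' \<in> bitstrings l \<Longrightarrow>
      (\<And>i. i \<in> {..<l} - F u \<Longrightarrow> u' i = u i) \<Longrightarrow> g u' = g u"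
  defines "P \<equiv> Pi_pmf {..<l} False (\<lambda>_. B :: bool pmf)"
  shows "measure_pmf.prob P {u. E u \<and> pmf (map_pmf g P) (g u) < c} \<le> c powr lam *
    measure_pmf.expectation P
      (\<lambda>u. if E u then (\<Prod>i\<in>{..<l} - F u. pmf B (u i) powr - lam) else 0)"
proof -
  define w where "w u = (\<Prod>i\<in>{..<l} - F u. pmf B (u i))" for u
  define h where "h u = (if E u then (\<Prod>i\<in>{..<l} - F u. pmf B (u i) powr - lam) else 0)" for u
  have fin: "finite (set_pmf P)" unfolding P_def by (intro finite_set_Pi_pmf) auto
  have int: "integrable (measure_pmf P) k" for k :: "_ \<Rightarrow> real"
    by (rule integrable_measure_pmf_finite[OF fin])
  have wpos: "w u > 0" for u unfolding w_def by (intro prod_pos ballI B)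
  have "measure_pmf.prob P {u. E u \<and> pmf (map_pmf g P) (g u) < c} =
      measure_pmf.expectation P (indicator {u. E u \<and> pmf (map_pmf g P) (g u) < c})"
    by simp
  also have "\<dots> \<le> measure_pmf.expectation P (\<lambda>u. c powr lam * h u)"
  proof (rule integral_mono_AE[OF int int], unfold AE_measure_pmf_iff, rule ballI)
    fix u assume "u \<in> set_pmf P"
    then have u: "u \<in> bitstrings l" using set_Pi_pmf_bitstrings[of l "\<lambda>_. B"] by (auto simp: P_def)
    show "indicator {u. E u \<and> pmf (map_pmf g P) (g u) < c} u \<le> c powr lam * h u"
    proof (cases "E u \<and> pmf (map_pmf g P) (g u) < c")
      case True
      have "w u \<le> pmf (map_pmf g P) (g u)"
        unfolding w_def P_def by (rule pmf_map_ge_cylinder) (rule inv[OF u conjunct1[OF True]])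
      then have "w u \<le> c" using True by simp
      then have "1 \<le> (c / w u) powr lam" using wpos[of u] lam by (intro ge_one_powr_ge_zero) auto
      also have "\<dots> = c powr lam * w u powr - lam"
        using wpos[of u] c by (simp add: powr_divide powr_minus_divide)
      also have "w u powr - lam = h u"
        using True by (simp add: w_def h_def prod_powr_distrib)
      finally show ?thesis by (auto simp: indicator_def)
    next
      case False
      moreover have "0 \<le> h u" unfolding h_def by (auto intro!: prod_nonneg)
      ultimately show ?thesis by (auto simp: indicator_def)
    qed
  qed
  finally show ?thesis unfolding h_def by simp
qed

text \<open>The part of u in I is erased before F is applied, so conditioning on the inputs outside
  I fixes F. Then the product factorises: a coordinate in F contributes 1, any other one the factor
  a, and as a is at least 1, having more than M coordinates in F only helps.\<close>

lemma expectation_inverse_weight_le: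
  assumes I: "I \<subseteq> {..<l}" and F: "\<And>y. F y \<subseteq> I"
    and a: "a = measure_pmf.expectation B (\<lambda>v. pmf B v powr - lam)" "a \<ge> 1"
  shows "measure_pmf.expectation (Pi_pmf {..<l} False (\<lambda>_. B :: bool pmf))
      (\<lambda>u. if M \<le> card (F (\<lambda>i. i \<notin> I \<and> u i))
        then (\<Prod>i\<in>{..<l} - F (\<lambda>i. i \<notin> I \<and> u i). pmf B (u i) powr - lam) else 0) \<le> a ^ (l - M)"
proof -
  define PY where "PY = Pi_pmf ({..<l} - I) False (\<lambda>_. B)"
  define PX where "PX = Pi_pmf I False (\<lambda>_. B)"
  define W where "W y = (\<Prod>i\<in>{..<l} - I. pmf B (y i) powr - lam)" for y
  have finI: "finite I" using I finite_subset by blast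
  have fin: "finite (set_pmf PY)" unfolding PY_def by (intro finite_set_Pi_pmf) auto
  have int: "integrable (measure_pmf PY) k" for k :: "_ \<Rightarrow> real"
    by (rule integrable_measure_pmf_finite[OF fin])
  define h where "h u = (if M \<le> card (F (\<lambda>i. i \<notin> I \<and> u i))
        then (\<Prod>i\<in>{..<l} - F (\<lambda>i. i \<notin> I \<and> u i). pmf B (u i) powr - lam) else 0)" for u
  have "measure_pmf.expectation (Pi_pmf {..<l} False (\<lambda>_. B)) h =
      measure_pmf.expectation PY (\<lambda>y. measure_pmf.expectation PX (\<lambda>x. h (\<lambda>i. if i \<in> I then x i else y i)))"
    unfolding PY_def PX_def by (rule expectation_Pi_pmf_split) (use I in auto)
  also have "\<dots> \<le> measure_pmf.expectation PY (\<lambda>y. a ^ (card I - M) * W y)"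
  proof (rule integral_mono_AE[OF int int], unfold AE_measure_pmf_iff, rule ballI)
    fix y assume "y \<in> set_pmf PY"
    then have y: "\<And>i. i \<in> I \<Longrightarrow> \<not> y i"
      using set_Pi_pmf_subset[of "{..<l} - I" False "\<lambda>_. B"] by (auto simp: PY_def)
    have yy: "(\<lambda>i. i \<notin> I \<and> (if i \<in> I then x i else y i)) = y" for x using y by auto
    have W0: "W y \<ge> 0" unfolding W_def by (auto intro!: prod_nonneg)
    show "measure_pmf.expectation PX (\<lambda>x. h (\<lambda>i. if i \<in> I then x i else y i)) \<le> a ^ (card I - M) * W y"
    proof (cases "M \<le> card (F y)")
      case True
      have "h (\<lambda>i. if i \<in> I then x i else y i) =
          W y * (\<Prod>i\<in>I. if i \<in> F y then 1 else pmf B (x i) powr - lam)" for x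
      proof -
        have "{..<l} - F y = ({..<l} - I) \<union> (I - F y)" using I F[of y] by auto
        then have "h (\<lambda>i. if i \<in> I then x i else y i) =
            (\<Prod>i\<in>({..<l} - I) \<union> (I - F y). pmf B (if i \<in> I then x i else y i) powr - lam)"
          unfolding h_def yy using True by simp
        also have "\<dots> = (\<Prod>i\<in>{..<l} - I. pmf B (if i \<in> I then x i else y i) powr - lam) *
            (\<Prod>i\<in>I - F y. pmf B (if i \<in> I then x i else y i) powr - lam)"
          using finI by (intro prod.union_disjoint) auto
        also have "(\<Prod>i\<in>{..<l} - I. pmf B (if i \<in> I then x i else y i) powr - lam) = W y"
          unfolding W_def by (intro prod.cong) auto
        also have "(\<Prod>i\<in>I - F y. pmf B (if i \<in> I then x i else y i) powr - lam) =
            (\<Prod>i\<in>I. if i \<in> F y then 1 else pmf B (x i) powr - lam)"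
          using finI by (intro prod.mono_neutral_cong_left) auto
        finally show ?thesis .
      qed
      then have "measure_pmf.expectation PX (\<lambda>x. h (\<lambda>i. if i \<in> I then x i else y i)) =
          W y * measure_pmf.expectation PX (\<lambda>x. \<Prod>i\<in>I. if i \<in> F y then 1 else pmf B (x i) powr - lam)"
        by simp
      also have "measure_pmf.expectation PX (\<lambda>x. \<Prod>i\<in>I. if i \<in> F y then 1 else pmf B (x i) powr - lam) =
          (\<Prod>i\<in>I. measure_pmf.expectation B (\<lambda>v. if i \<in> F y then 1 else pmf B v powr - lam))"
        unfolding PX_def using finI by (intro expectation_prod_Pi_pmf_finite) auto
      also have "\<dots> = (\<Prod>i\<in>I - F y. a)"
        using finI by (intro prod.mono_neutral_cong_right) (auto simp: a(1))
      also have "\<dots> = a ^ (card I - card (F y))"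
        using F[of y] finite_subset[OF F[of y] finI] by (simp add: card_Diff_subset)
      also have "W y * \<dots> \<le> W y * a ^ (card I - M)"
        using True a(2) W0 by (intro mult_left_mono power_increasing) auto
      finally show ?thesis by (simp add: mult.commute)
    next
      case False
      then have "h (\<lambda>i. if i \<in> I then x i else y i) = 0" for x unfolding h_def yy by simp
      then show ?thesis using W0 a(2) by simp
    qed
  qed
  also have "\<dots> = a ^ (card I - M) * a ^ (l - card I)"
  proof -
    have "measure_pmf.expectation PY W = (\<Prod>i\<in>{..<l} - I. a)"
      unfolding W_def PY_def a(1) by (intro expectation_prod_Pi_pmf_finite) auto
    also have "\<dots> = a ^ (l - card I)" using I finI by (simp add: card_Diff_subset)
    finally show ?thesis by simp
  qed
  also have "\<dots> = a ^ (card I - M + (l - card I))" by (simp add: power_add)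
  \<comment> \<open>Natural subtraction makes the exponents add up to l - M only in this case;
    otherwise the condition on F never holds and the integrand vanishes.\<close>
  also have "\<dots> \<le> a ^ (l - M)" if "M \<le> card I"
  proof -
    have "card I \<le> l" using card_mono[OF _ I] by simp
    then show ?thesis using that a(2) by (intro power_increasing) auto
  qed
  finally have main: "measure_pmf.expectation (Pi_pmf {..<l} False (\<lambda>_. B)) h \<le> a ^ (l - M)"
    if "M \<le> card I" using that by simp
  show ?thesis
  proof (cases "M \<le> card I")
    case True then show ?thesis using main unfolding h_def by simp
  next
    case False
    have "\<not> M \<le> card (F y)" for y using False card_mono[OF finI F[of y]] by linarith
    then show ?thesis using a(2) by simp
  qed
qed

text \<open>On this set Q is pointwise at most \<kappa> / c times P. In the application Q is the
  target, whose atoms have mass at most 2^(-N).\<close>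

lemma prob_heavy_le:
  assumes "finite (set_pmf Q)" "\<And>z. pmf Q z \<le> \<kappa>" "c > 0" "0 \<le> \<kappa>"
  shows "measure_pmf.prob Q {z. c \<le> pmf P z} \<le> \<kappa> / c"
proof -
  define S where "S = {z. c \<le> pmf P z} \<inter> set_pmf Q"
  have S: "finite S" using assms by (simp add: S_def)
  have "measure_pmf.prob Q {z. c \<le> pmf P z} = measure_pmf.prob Q S"
    unfolding S_def by (simp add: measure_Int_set_pmf)
  also have "\<dots> = (\<Sum>z\<in>S. pmf Q z)" by (rule measure_measure_pmf_finite[OF S])
  also have "\<dots> \<le> (\<Sum>z\<in>S. \<kappa> / c * pmf P z)"
  proof (rule sum_mono)
    fix z assume "z \<in> S"
    then have "1 \<le> pmf P z / c" using assms by (simp add: S_def)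
    then have "\<kappa> \<le> \<kappa> * (pmf P z / c)" using assms(4) by (metis mult.right_neutral mult_left_mono)
    then show "pmf Q z \<le> \<kappa> / c * pmf P z" using assms(2)[of z] by simp
  qed
  also have "\<dots> = \<kappa> / c * measure_pmf.prob P S"
    by (simp add: measure_measure_pmf_finite[OF S] sum_distrib_left)
  also have "\<dots> \<le> \<kappa> / c" using assms by (intro mult_left_le) auto
  finally show ?thesis .
qed

lemma tv_dist_ge: "measure_pmf.prob P A - measure_pmf.prob Q A \<le> tv_dist P Q"
proof -
  have "\<bar>measure_pmf.prob P S - measure_pmf.prob Q S\<bar> \<le> 1" for S
    using measure_pmf.prob_le_1[of P S] measure_pmf.prob_le_1[of Q S]
      measure_nonneg[of "measure_pmf P" S] measure_nonneg[of "measure_pmf Q" S] by linarith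
  then have "bdd_above (range (\<lambda>S. \<bar>measure_pmf.prob P S - measure_pmf.prob Q S\<bar>))"
    by (intro bdd_aboveI[of _ 1]) auto
  then have "\<bar>measure_pmf.prob P A - measure_pmf.prob Q A\<bar> \<le> tv_dist P Q"
    unfolding tv_dist_def by (intro cSUP_upper) auto
  then show ?thesis by linarith
qed

section \<open>The target distribution\<close>

definition append_pmm :: "nat \<Rightarrow> nat \<Rightarrow> (nat \<Rightarrow> bool) \<Rightarrow> nat \<Rightarrow> bool" where
  "append_pmm p K z j = (if j < 2 * K then z j else if j = 2 * K then pmm_bits p (Suc K) z else False)"

lemma target_dist_eq: "target_dist p (Suc K) = map_pmf (append_pmm p K) (unif_bits (2 * K))"
proof -
  have "2 * Suc K - 2 = 2 * K" by simp
  then show ?thesis unfolding target_dist_def append_pmm_def[abs_def] Let_def by (simp only:)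
qed

lemma vtx_cong:
  assumes "\<And>j. j < 2 * K \<Longrightarrow> z j = z' j" "m \<in> {1..K}"
  shows "vtx K z m = vtx K z' m"
proof -
  have "z (j - 1) = z' (j - 1)" if "j \<in> path_edges m" for j
    using path_edges_bounds[OF that] assms(2) by (intro assms(1)) auto
  then show ?thesis unfolding vtx_def using assms by (auto intro!: hbit_cong)
qed

lemma pmm_bits_cong:
  assumes "\<And>j. j < 2 * K \<Longrightarrow> z j = z' j" "K \<ge> 1"
  shows "pmm_bits p (Suc K) z = pmm_bits p (Suc K) z'"
proof -
  have "sgnb (pmm_bits p (Suc K) z) = sgnb (pmm_bits p (Suc K) z')"
    unfolding sgnb_pmm_bits[OF assms(2)] using vtx_cong[OF assms(1)] by simp
  then show ?thesis by (simp add: sgnb_def split: if_splits)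
qed

lemma finite_set_target_dist: "finite (set_pmf (target_dist p (Suc K)))"
  unfolding target_dist_eq unif_bits_def by (auto intro!: finite_set_Pi_pmf)

text \<open>Appending a bit that is a function of the others merges no two atoms of the uniform
  distribution.\<close>

lemma pmf_target_dist_le: "pmf (target_dist p (Suc K)) z \<le> (1/2) ^ (2 * K)"
proof -
  have inj: "inj_on (append_pmm p K) (bitstrings (2 * K))"
  proof (rule inj_onI, rule ext)
    fix z z' j assume z: "z \<in> bitstrings (2 * K)" "z' \<in> bitstrings (2 * K)"
      and eq: "append_pmm p K z = append_pmm p K z'"
    show "z j = z' j"
      using z fun_cong[OF eq, of j] by (cases "j < 2 * K") (auto simp: bitstrings_def append_pmm_def)
  qed
  define S where "S = append_pmm p K -` {z} \<inter> set_pmf (unif_bits (2 * K))"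
  have sub: "set_pmf (unif_bits (2 * K)) \<subseteq> bitstrings (2 * K)"
    unfolding unif_bits_def by (rule set_Pi_pmf_bitstrings)
  have fS: "finite S" using finite_subset[OF sub] by (simp add: S_def)
  have "x = y" if "x \<in> S" "y \<in> S" for x y
    using inj_onD[OF inj, of x y] that sub by (auto simp: S_def)
  then have "card S \<le> 1" using card_le_Suc0_iff_eq[OF fS] by simp
  have "pmf (target_dist p (Suc K)) z = measure_pmf.prob (unif_bits (2 * K)) S"
    unfolding target_dist_eq pmf_map S_def by (simp add: measure_Int_set_pmf)
  also have "\<dots> = (\<Sum>z\<in>S. pmf (unif_bits (2 * K)) z)" by (rule measure_measure_pmf_finite[OF fS])
  also have "\<dots> \<le> (\<Sum>z\<in>S. (1/2) ^ (2 * K))"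
    by (rule sum_mono) (simp only: pmf_unif_bits, simp)
  also have "\<dots> = real (card S) * (1/2) ^ (2 * K)" by simp
  also have "\<dots> \<le> 1 * (1/2) ^ (2 * K)" using \<open>card S \<le> 1\<close> by (intro mult_right_mono) auto
  finally show ?thesis by simp
qed

text \<open>Chebyshev's inequality. Disjoint blocks are pairwise independent under the uniform
  distribution, so the variance is at most the mean \<mu>.\<close>

lemma prob_few_special_le:
  assumes I: "finite I" and V: "\<And>i. i \<in> I \<Longrightarrow> V i \<subseteq> {1..K}"
    and disj: "\<And>i j. i \<in> I \<Longrightarrow> j \<in> I \<Longrightarrow> i \<noteq> j \<Longrightarrow> V i \<inter> V j = {}"
    and mu: "\<mu> = (\<Sum>i\<in>I. (1/4) ^ card (V i))" "\<mu> > 0"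
  shows "measure_pmf.prob (target_dist p (Suc K)) {z. real (card {i \<in> I. special K (V i) z}) < \<mu> / 2} \<le> 4 / \<mu>"
proof -
  define P where "P = unif_bits (2 * K)"
  define X where "X z = (\<Sum>i\<in>I. indicator {z. special K (V i) z} z :: real)" for z
  have Xc: "real (card {i \<in> I. special K (V i) z}) = X z" for z
    using I by (simp add: X_def indicator_def sum.If_cases Int_def)
  have fin: "finite (set_pmf P)" unfolding P_def unif_bits_def by (intro finite_set_Pi_pmf) auto
  have int: "integrable (measure_pmf P) k" for k :: "_ \<Rightarrow> real"
    by (rule integrable_measure_pmf_finite[OF fin])
  have finV: "finite (V i)" if "i \<in> I" for i using V[OF that] finite_subset by blast
  have EX: "measure_pmf.expectation P X = \<mu>"
    unfolding X_def mu(1) using int V by (simp add: P_def prob_special)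
  have "measure_pmf.expectation P (\<lambda>z. (X z)\<^sup>2) =
      (\<Sum>i\<in>I. \<Sum>j\<in>I. measure_pmf.prob P {z. special K (V i \<union> V j) z})"
  proof -
    have "(X z)\<^sup>2 = (\<Sum>i\<in>I. \<Sum>j\<in>I. indicator {z. special K (V i \<union> V j) z} z)" for z
      unfolding X_def power2_eq_square sum_product
      by (intro sum.cong refl) (auto simp: indicator_def special_def)
    then show ?thesis using int by simp
  qed
  also have "\<dots> \<le> (\<Sum>i\<in>I. \<Sum>j\<in>I. (if i = j then (1/4) ^ card (V i) else 0) + (1/4) ^ card (V i) * (1/4) ^ card (V j))"
  proof (intro sum_mono)
    fix i j assume ij: "i \<in> I" "j \<in> I"
    have "measure_pmf.prob P {z. special K (V i \<union> V j) z} = (1/4) ^ card (V i \<union> V j)"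
      unfolding P_def using V ij by (intro prob_special) auto
    also have "\<dots> \<le> (if i = j then (1/4) ^ card (V i) else 0) + (1/4) ^ card (V i) * (1/4) ^ card (V j)"
      using disj[OF ij] finV ij by (auto simp: card_Un_disjoint power_add)
    finally show "measure_pmf.prob P {z. special K (V i \<union> V j) z} \<le> \<dots>" .
  qed
  also have "\<dots> = \<mu> + \<mu>\<^sup>2"
    using I by (simp add: sum.distrib mu(1) power2_eq_square sum_product)
  finally have EX2: "measure_pmf.expectation P (\<lambda>z. (X z)\<^sup>2) \<le> \<mu> + \<mu>\<^sup>2" .
  have "measure_pmf.prob (target_dist p (Suc K)) {z. real (card {i \<in> I. special K (V i) z}) < \<mu> / 2} =
      measure_pmf.prob P {z. X z < \<mu> / 2}"
  proof -
    have "special K (V i) (append_pmm p K z) = special K (V i) z" if "i \<in> I" for i z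
    proof -
      have "vtx K (append_pmm p K z) m = vtx K z m" if "m \<in> V i" for m
        using V[OF \<open>i \<in> I\<close>] that by (intro vtx_cong) (auto simp: append_pmm_def)
      then show ?thesis unfolding special_def by simp
    qed
    then have "append_pmm p K -` {z. real (card {i \<in> I. special K (V i) z}) < \<mu> / 2} = {z. X z < \<mu> / 2}"
      unfolding Xc[symmetric] by (auto cong: conj_cong)
    then show ?thesis unfolding target_dist_eq P_def by simp
  qed
  also have "\<dots> \<le> measure_pmf.prob P {z \<in> space (measure_pmf P). \<mu> / 2 \<le> \<bar>X z - measure_pmf.expectation P X\<bar>}"
    unfolding EX using mu(2) by (intro measure_pmf.finite_measure_mono) auto
  also have "\<dots> \<le> measure_pmf.variance P X / (\<mu> / 2)\<^sup>2"
    using int mu(2) by (intro measure_pmf.Chebyshev_inequality) auto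
  also have "measure_pmf.variance P X = measure_pmf.expectation P (\<lambda>z. (X z)\<^sup>2) - \<mu>\<^sup>2"
    using measure_pmf.variance_eq[OF int int, of X] unfolding EX .
  also have "(measure_pmf.expectation P (\<lambda>z. (X z)\<^sup>2) - \<mu>\<^sup>2) / (\<mu> / 2)\<^sup>2 \<le> \<mu> / (\<mu> / 2)\<^sup>2"
    using EX2 by (intro divide_right_mono) auto
  also have "\<dots> = 4 / \<mu>" using mu(2) by (simp add: power2_eq_square)
  finally show ?thesis .
qed

section \<open>Local samplers\<close>

text \<open>\<open>S j\<close> is one fixed choice of the inputs that output bit j may read; bounds
  on its size are hypotheses of individual lemmas. The degenerate values q = 0 and q = 1 have
  entropy 0, which H(B_b) = 1/k excludes.\<close>

locale local_sampler =
  fixes l K :: nat and q :: real and f :: "(nat \<Rightarrow> bool) \<Rightarrow> nat \<Rightarrow> bool" and S :: "nat \<Rightarrow> nat set"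
  assumes K: "K \<ge> 1" and q: "0 < q" "q < 1"
    and S: "\<And>j. j < 2 * K + 1 \<Longrightarrow> S j \<subseteq> {..<l}"
    and dep: "\<And>j u u'. j < 2 * K + 1 \<Longrightarrow> u \<in> bitstrings l \<Longrightarrow> u' \<in> bitstrings l \<Longrightarrow>
      (\<And>i. i \<in> S j \<Longrightarrow> u i = u' i) \<Longrightarrow> f u j = f u' j"
begin

definition out :: "(nat \<Rightarrow> bool) \<Rightarrow> nat \<Rightarrow> bool" where
  "out u j = (if j < 2 * K + 1 then f u j else False)"

definition inp :: "(nat \<Rightarrow> bool) pmf" where
  "inp = Pi_pmf {..<l} False (\<lambda>_. bernoulli_pmf q)"

text \<open>\<open>SV m\<close> collects the inputs that the pair \<open>(h\<^sub>m, x\<^sub>m)\<close> may depend on, and \<open>nbh i\<close> is the block of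
  vertices that input \<open>i\<close> may influence.\<close>
definition SV :: "nat \<Rightarrow> nat set" where
  "SV m = S (K - 1 + m) \<union> (\<Union>j\<in>path_edges m. S (j - 1))"

definition nbh :: "nat \<Rightarrow> nat set" where
  "nbh i = {m \<in> {1..K}. i \<in> SV m}"

text \<open>For 0 < lam < 1 this is exp (lam * R), where R is the Renyi entropy of order 1 - lam of
  one input bit, in nats.\<close>

definition moment :: "real \<Rightarrow> real" where
  "moment lam = q powr (1 - lam) + (1 - q) powr (1 - lam)"

lemma pmf_pos: "pmf (bernoulli_pmf q) v > 0"
  using q by (cases v) auto

lemma moment_eq: "moment lam = measure_pmf.expectation (bernoulli_pmf q) (\<lambda>v. pmf (bernoulli_pmf q) v powr - lam)"
proof -
  have "x * x powr - lam = x powr (1 - lam)" if "x > 0" for x :: real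
    using that powr_add[of x 1 "- lam"] by simp
  then show ?thesis using q by (simp add: moment_def mult.commute)
qed

lemma moment_ge_1:
  assumes "lam \<ge> 0"
  shows "moment lam \<ge> 1"
proof -
  have "x \<le> x powr (1 - lam)" if "0 < x" "x < 1" for x :: real
    using powr_mono'[of "1 - lam" 1 x] that assms by simp
  from this[of q] this[of "1 - q"] show ?thesis using q by (simp add: moment_def)
qed

lemma out_cong:
  assumes "u \<in> bitstrings l" "u' \<in> bitstrings l" "\<And>i. i \<in> S j \<Longrightarrow> u i = u' i"
  shows "out u j = out u' j"
  using dep[of j u u'] assms by (simp add: out_def)

lemma vtx_out_cong:
  assumes "m \<in> {1..K}" "u \<in> bitstrings l" "u' \<in> bitstrings l" "\<And>i. i \<in> SV m \<Longrightarrow> u i = u' i"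
  shows "vtx K (out u) m = vtx K (out u') m"
proof -
  have "out u (j - 1) = out u' (j - 1)" if "j \<in> path_edges m" for j
    by (rule out_cong[OF assms(2,3)]) (use that assms(4) in \<open>auto simp: SV_def\<close>)
  moreover have "out u (K - 1 + m) = out u' (K - 1 + m)"
    by (rule out_cong[OF assms(2,3)]) (use assms(4) in \<open>auto simp: SV_def\<close>)
  ultimately show ?thesis unfolding vtx_def by (auto intro!: hbit_cong)
qed

text \<open>Inputs outside R are never read, so every output contains a cylinder that fixes the
  inputs in R only, and the exponent of the moment drops from l to card R. No small tilt is required
  here: 1/2 suffices, because the gap to be exploited is linear in N.\<close>

lemma tv_dist_low_entropy:
  assumes "c > 0"
  defines "R \<equiv> (\<Union>j<2 * K + 1. S j)"
  shows "1 - c powr (1/2) * moment (1/2) ^ card R - (1/2) ^ (2 * K) / c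
    \<le> tv_dist (map_pmf out inp) (target_dist p (Suc K))"
proof -
  define T where "T = {z. c \<le> pmf (map_pmf out inp) z}"
  define I where "I = {..<l} - R"
  have R: "R \<subseteq> {..<l}" unfolding R_def using S by blast
  have cI: "l - card I = card R" "card I \<le> l"
  proof -
    have "card I = l - card R" using R finite_subset[OF R] by (simp add: I_def card_Diff_subset)
    moreover have "card R \<le> l" using card_mono[OF _ R] by simp
    ultimately show "l - card I = card R" "card I \<le> l" by auto
  qed
  have inv: "out u' = out u"
    if "u \<in> bitstrings l" "u' \<in> bitstrings l" "\<And>i. i \<in> {..<l} - I \<Longrightarrow> u' i = u i" for u u'
  proof
    fix j show "out u' j = out u j"
    proof (cases "j < 2 * K + 1")
      case True
      then have "S j \<subseteq> {..<l} - I" using R by (auto simp: I_def R_def)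
      then show ?thesis using that by (intro out_cong) auto
    qed (simp add: out_def)
  qed
  define h where "h u = (\<Prod>i\<in>{..<l} - I. pmf (bernoulli_pmf q) (u i) powr - (1/2))" for u
  have "measure_pmf.prob inp {u. True \<and> pmf (map_pmf out inp) (out u) < c} \<le> c powr (1/2) *
      measure_pmf.expectation inp (\<lambda>u. if True then h u else 0)"
    unfolding inp_def h_def
    by (rule prob_light_output_le[OF pmf_pos assms(1)]) (simp, rule inv)
  then have "measure_pmf.prob inp {u. pmf (map_pmf out inp) (out u) < c} \<le> c powr (1/2) *
      measure_pmf.expectation inp h" by simp
  \<comment> \<open>The condition is always true; it brings the integrand into the form treated
    above, with M = card I and F constantly I.\<close>
  also have "measure_pmf.expectation inp h =
      measure_pmf.expectation inp (\<lambda>u. if card I \<le> card I then h u else 0)" by simp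
  also have "\<dots> \<le> moment (1/2) ^ (l - card I)"
    unfolding inp_def h_def
    by (rule expectation_inverse_weight_le[where F = "\<lambda>_. I" and I = I, OF _ _ moment_eq moment_ge_1])
      (auto simp: I_def)
  finally have "measure_pmf.prob inp {u. pmf (map_pmf out inp) (out u) < c}
      \<le> c powr (1/2) * moment (1/2) ^ card R"
    unfolding cI(1) by (simp add: mult_left_mono)
  moreover have "measure_pmf.prob inp {u. pmf (map_pmf out inp) (out u) < c} =
      1 - measure_pmf.prob (map_pmf out inp) T"
  proof -
    have "{u. pmf (map_pmf out inp) (out u) < c} = UNIV - out -` T" by (auto simp: T_def)
    then show ?thesis using measure_pmf.prob_compl[of "out -` T" inp] by simp
  qed
  moreover have "measure_pmf.prob (target_dist p (Suc K)) T \<le> (1/2) ^ (2 * K) / c"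
    unfolding T_def by (rule prob_heavy_le) (use finite_set_target_dist pmf_target_dist_le assms in auto)
  moreover note tv_dist_ge[of "map_pmf out inp" T "target_dist p (Suc K)"]
  ultimately show ?thesis by linarith
qed

end

section \<open>Inputs with disjoint blocks\<close>

lemma wt_bounds: "\<bar>wt w\<bar> \<le> 1" "w \<noteq> (False, True) \<Longrightarrow> wt w \<le> 0" "wt (False, True) = 1"
  by (cases w; auto simp: wt_def)+

text \<open>The inputs of I do not reach the last output bit, so fixing all others makes this bit
  constant while the labels may still vary.\<close>

locale local_sampler_blocks = local_sampler +
  fixes I :: "nat set"
  assumes I: "I \<subseteq> {..<l}" "I \<inter> S (2 * K) = {}"
    and disj: "\<And>i j. i \<in> I \<Longrightarrow> j \<in> I \<Longrightarrow> i \<noteq> j \<Longrightarrow> nbh i \<inter> nbh j = {}"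
begin

definition rest :: "(nat \<Rightarrow> bool) \<Rightarrow> nat \<Rightarrow> bool" where
  "rest u i = (i \<notin> I \<and> u i)"

text \<open>For y = \<open>rest u\<close> the other inputs of I are held at 0. Since blocks are
  disjoint these inputs do not reach \<open>nbh i\<close>, so their values are immaterial and being
  frozen is a matter of the inputs outside I and of i alone.\<close>

definition frozen :: "(nat \<Rightarrow> bool) \<Rightarrow> nat set" where
  "frozen y = {i \<in> I. \<forall>m\<in>nbh i. vtx K (out (y(i := True))) m = vtx K (out (y(i := False))) m}"

lemma finite_I: "finite I" using I finite_subset by blast

lemma rest_bitstrings: "u \<in> bitstrings l \<Longrightarrow> rest u \<in> bitstrings l"
  by (auto simp: bitstrings_def rest_def)

lemma upd_bitstrings: "u \<in> bitstrings l \<Longrightarrow> i \<in> I \<Longrightarrow> u(i := v) \<in> bitstrings l"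
  using I by (auto simp: bitstrings_def)

text \<open>Any input of I that a vertex of \<open>nbh i\<close> may depend on is i itself, for
  otherwise the vertex would lie in two blocks.\<close>

lemma vtx_block:
  assumes "u \<in> bitstrings l" "i \<in> I" "m \<in> nbh i"
  shows "vtx K (out u) m = vtx K (out ((rest u)(i := u i))) m"
proof (rule vtx_out_cong)
  fix i' assume i': "i' \<in> SV m"
  have "i' \<in> I \<Longrightarrow> i' = i" using disj[of i i'] assms i' by (auto simp: nbh_def)
  then show "u i' = ((rest u)(i := u i)) i'" by (auto simp: rest_def)
qed (use assms rest_bitstrings upd_bitstrings in \<open>auto simp: nbh_def\<close>)

lemma vtx_no_block:
  assumes "u \<in> bitstrings l" "m \<in> {1..K}" "\<And>i. i \<in> I \<Longrightarrow> m \<notin> nbh i"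
  shows "vtx K (out u) m = vtx K (out (rest u)) m"
  by (rule vtx_out_cong) (use assms rest_bitstrings in \<open>auto simp: nbh_def rest_def\<close>)

lemma out_last:
  assumes "u \<in> bitstrings l"
  shows "out u (2 * K) = out (rest u) (2 * K)"
  by (rule out_cong) (use assms rest_bitstrings I in \<open>auto simp: rest_def\<close>)

text \<open>Frozen inputs are therefore free coordinates of the cylinder in
  \<open>prob_light_output_le\<close>. Equality is checked on the vertex labels, which determine the
  first 2 K output bits; the last bit does not see I.\<close>

lemma out_frozen_invariant:
  assumes u: "u \<in> bitstrings l" and u': "u' \<in> bitstrings l"
    and eq: "\<And>i. i \<in> {..<l} - frozen (rest u) \<Longrightarrow> u' i = u i"
  shows "out u' = out u"
proof
  have "rest u' i = rest u i" for i
    using eq[of i] u u' by (cases "i < l") (auto simp: rest_def frozen_def bitstrings_def)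
  then have r: "rest u' = rest u" by auto
  have v: "vtx K (out u') m = vtx K (out u) m" if m: "m \<in> {1..K}" for m
  proof (cases "\<exists>i\<in>I. m \<in> nbh i")
    case True
    then obtain i where i: "i \<in> I" "m \<in> nbh i" by blast
    have "vtx K (out ((rest u)(i := u' i))) m = vtx K (out ((rest u)(i := u i))) m"
    proof (cases "i \<in> frozen (rest u)")
      case True
      then have fr: "vtx K (out ((rest u)(i := True))) m = vtx K (out ((rest u)(i := False))) m"
        using i unfolding frozen_def by blast
      show ?thesis by (cases "u i"; cases "u' i") (simp_all add: fr)
    next
      case False
      then show ?thesis using eq[of i] i I by auto
    qed
    then show ?thesis using vtx_block[OF u i] vtx_block[OF u' i] r by simp
  next
    case False
    then show ?thesis using vtx_no_block[OF u m] vtx_no_block[OF u' m] r by simp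
  qed
  fix j
  consider "j < 2 * K" | "j = 2 * K" | "j > 2 * K" by linarith
  then show "out u' j = out u j"
  proof cases
    case 1 show ?thesis by (rule vtx_determines_bits[OF v 1])
  next
    case 2 then show ?thesis using out_last[OF u] out_last[OF u'] r by simp
  qed (simp add: out_def)
qed

definition blk_wt :: "(nat \<Rightarrow> bool) \<Rightarrow> nat \<Rightarrow> bool \<Rightarrow> int" where
  "blk_wt y i v = (\<Sum>m\<in>nbh i. wt (vtx K (out (y(i := v))) m))"

definition blk_sgn :: "(nat \<Rightarrow> bool) \<Rightarrow> nat \<Rightarrow> bool \<Rightarrow> real" where
  "blk_sgn y i v = (\<Prod>m\<in>nbh i. sgnb (snd (vtx K (out (y(i := v))) m)))"

definition can_special :: "(nat \<Rightarrow> bool) \<Rightarrow> nat set" where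
  "can_special y = {i \<in> I. \<exists>v. special K (nbh i) (out (y(i := v)))}"

text \<open>A special block has the maximal weight, and it is the only pattern with this weight; so a block
  that can be special and is not frozen takes two different weights.\<close>
lemma blk_wt_varies:
  assumes i: "i \<in> can_special y - frozen y" and p: "2 * card (nbh i) < p"
  shows "\<not> int p dvd blk_wt y i True - blk_wt y i False"
proof -
  obtain v where v: "special K (nbh i) (out (y(i := v)))" using i by (auto simp: can_special_def)
  have "i \<in> I" using i by (auto simp: can_special_def)
  have fin: "finite (nbh i)" by (simp add: nbh_def)
  have max: "blk_wt y i v = int (card (nbh i))"
    using v by (simp add: blk_wt_def special_def wt_bounds(3))
  obtain m where m: "m \<in> nbh i" "vtx K (out (y(i := (\<not> v)))) m \<noteq> vtx K (out (y(i := v))) m"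
    using i \<open>i \<in> I\<close> unfolding frozen_def by (cases v) force+
  then have "vtx K (out (y(i := (\<not> v)))) m \<noteq> (False, True)" using v by (auto simp: special_def)
  then have m0: "wt (vtx K (out (y(i := (\<not> v)))) m) \<le> 0" by (rule wt_bounds)
  have wb: "wt w \<le> 1" "- 1 \<le> wt w" for w using wt_bounds(1)[of w] by linarith+
  have "blk_wt y i (\<not> v) = wt (vtx K (out (y(i := (\<not> v)))) m) +
      (\<Sum>m\<in>nbh i - {m}. wt (vtx K (out (y(i := (\<not> v)))) m))"
    unfolding blk_wt_def using fin m by (simp add: sum.remove)
  also have "\<dots> \<le> 0 + (\<Sum>m\<in>nbh i - {m}. 1)" using m0 wb by (intro add_mono sum_mono) auto
  also have "\<dots> < int (card (nbh i))"
    using m(1) fin card_gt_0_iff[of "nbh i"] by (auto simp: of_nat_diff)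
  finally have lt: "blk_wt y i (\<not> v) < int (card (nbh i))" .
  have "(\<Sum>m\<in>nbh i. - 1) \<le> blk_wt y i (\<not> v)" unfolding blk_wt_def using wb by (intro sum_mono) auto
  then have ge: "- int (card (nbh i)) \<le> blk_wt y i (\<not> v)" by simp
  \<comment> \<open>The difference is positive and at most 2 * card (nbh i), hence below p.\<close>
  have "\<not> int p dvd blk_wt y i v - blk_wt y i (\<not> v)"
    using max lt ge p by (auto dest: zdvd_imp_le)
  then show ?thesis by (cases v) (auto simp: dvd_diff_commute)
qed

text \<open>With the inputs outside I fixed, the vertices in no block give constants and each block
  depends on its own input only. This is the sum and product form that \<open>MM_parity_bias\<close>
  requires.\<close>

lemma blk_decomposition:
  assumes "u \<in> bitstrings l"
  defines "Z \<equiv> {1..K} - (\<Union>i\<in>I. nbh i)"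
  shows "(\<Sum>m\<in>{1..K}. wt (vtx K (out u) m)) =
      (\<Sum>m\<in>Z. wt (vtx K (out (rest u)) m)) + (\<Sum>i\<in>I. blk_wt (rest u) i (u i))"
    and "(\<Prod>m\<in>{1..K}. sgnb (snd (vtx K (out u) m))) =
      (\<Prod>m\<in>Z. sgnb (snd (vtx K (out (rest u)) m))) * (\<Prod>i\<in>I. blk_sgn (rest u) i (u i))"
proof -
  have split: "{1..K} = Z \<union> (\<Union>i\<in>I. nbh i)" by (auto simp: Z_def nbh_def)
  have fin: "finite Z" "finite (\<Union>i\<in>I. nbh i)" "Z \<inter> (\<Union>i\<in>I. nbh i) = {}" "\<forall>i\<in>I. finite (nbh i)"
    using finite_I by (auto simp: Z_def nbh_def)
  have d: "\<forall>i\<in>I. \<forall>j\<in>I. i \<noteq> j \<longrightarrow> nbh i \<inter> nbh j = {}" using disj by blast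
  have Z: "vtx K (out u) m = vtx K (out (rest u)) m" if "m \<in> Z" for m
    using that by (intro vtx_no_block assms(1)) (auto simp: Z_def)
  have "(\<Sum>m\<in>{1..K}. wt (vtx K (out u) m)) =
      (\<Sum>m\<in>Z. wt (vtx K (out u) m)) + (\<Sum>i\<in>I. \<Sum>m\<in>nbh i. wt (vtx K (out u) m))"
    unfolding split sum.union_disjoint[OF fin(1,2,3)] sum.UNION_disjoint[OF finite_I fin(4) d] ..
  also have "(\<Sum>i\<in>I. \<Sum>m\<in>nbh i. wt (vtx K (out u) m)) = (\<Sum>i\<in>I. blk_wt (rest u) i (u i))"
    unfolding blk_wt_def using vtx_block[OF assms(1)] by (intro sum.cong refl) auto
  finally show "(\<Sum>m\<in>{1..K}. wt (vtx K (out u) m)) =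
      (\<Sum>m\<in>Z. wt (vtx K (out (rest u)) m)) + (\<Sum>i\<in>I. blk_wt (rest u) i (u i))"
    using Z by simp
  have "(\<Prod>m\<in>{1..K}. sgnb (snd (vtx K (out u) m))) =
      (\<Prod>m\<in>Z. sgnb (snd (vtx K (out u) m))) * (\<Prod>i\<in>I. \<Prod>m\<in>nbh i. sgnb (snd (vtx K (out u) m)))"
    unfolding split prod.union_disjoint[OF fin(1,2,3)] prod.UNION_disjoint[OF finite_I fin(4) d] ..
  also have "(\<Prod>i\<in>I. \<Prod>m\<in>nbh i. sgnb (snd (vtx K (out u) m))) = (\<Prod>i\<in>I. blk_sgn (rest u) i (u i))"
    unfolding blk_sgn_def using vtx_block[OF assms(1)] by (intro prod.cong refl) auto
  finally show "(\<Prod>m\<in>{1..K}. sgnb (snd (vtx K (out u) m))) =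
      (\<Prod>m\<in>Z. sgnb (snd (vtx K (out (rest u)) m))) * (\<Prod>i\<in>I. blk_sgn (rest u) i (u i))"
    using Z by simp
qed

lemma blk_sgn_sign: "blk_sgn y i v \<in> {-1, 1}"
proof -
  have "finite A \<Longrightarrow> (\<Prod>m\<in>A. sgnb (P m)) \<in> {-1, 1}" for A :: "nat set" and P
    by (induction A rule: finite_induct) (auto simp: sgnb_def)
  then show ?thesis unfolding blk_sgn_def by (simp add: nbh_def)
qed

lemma can_special_ge:
  assumes "u \<in> bitstrings l"
  shows "card {i \<in> I. special K (nbh i) (out u)} \<le> card (can_special (rest u))"
proof (rule card_mono)
  show "{i \<in> I. special K (nbh i) (out u)} \<subseteq> can_special (rest u)"
  proof
    fix i assume i: "i \<in> {i \<in> I. special K (nbh i) (out u)}"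
    then have "special K (nbh i) (out ((rest u)(i := u i)))"
      using vtx_block[OF assms, of i] by (simp add: special_def)
    then show "i \<in> can_special (rest u)" using i by (auto simp: can_special_def)
  qed
qed (use finite_I in \<open>auto simp: can_special_def\<close>)

text \<open>Two random signs differ with probability (1 - E)/2, where E is the expectation of their
  product. Here the product is a constant sign times the function bounded in
  \<open>MM_parity_bias\<close>.\<close>

lemma prob_wrong_last_bit_ge:
  assumes y: "y \<in> bitstrings l" "\<And>i. i \<in> I \<Longrightarrow> \<not> y i"
    and p: "prime p" "p > 2" "\<And>i. i \<in> I \<Longrightarrow> 2 * card (nbh i) < p"
    and M: "M \<le> card (can_special y - frozen y)"
  defines "mrg \<equiv> \<lambda>x i. if i \<in> I then x i else y i"
  shows "1/2 - (1 / real p + real p * sqrt (1 - 4 * q * (1 - q) / (real p)\<^sup>2) ^ M) / 2 \<le>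
    measure_pmf.prob (Pi_pmf I False (\<lambda>_. bernoulli_pmf q))
      {x. out (mrg x) (2 * K) \<noteq> pmm_bits p (Suc K) (out (mrg x))}"
proof -
  define PX where "PX = Pi_pmf I False (\<lambda>_. bernoulli_pmf q)"
  define Z where "Z = {1..K} - (\<Union>i\<in>I. nbh i)"
  define a0 where "a0 = (\<Sum>m\<in>Z. wt (vtx K (out y) m))"
  define e0 where "e0 = (\<Prod>m\<in>Z. sgnb (snd (vtx K (out y) m))) * sgnb (out y (2 * K))"
  define \<rho> where "\<rho> = sqrt (1 - 4 * q * (1 - q) / (real p)\<^sup>2)"
  define h where "h x = sgnb (MM (int p) (a0 + (\<Sum>i\<in>I. blk_wt y i (x i)))) * (\<Prod>i\<in>I. blk_sgn y i (x i))" for x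
  have mrg: "mrg x \<in> bitstrings l" "rest (mrg x) = y" for x
    using y I by (auto simp: mrg_def rest_def bitstrings_def fun_eq_iff)
  have fin: "finite (set_pmf PX)" unfolding PX_def using finite_I by (intro finite_set_Pi_pmf) auto
  have int: "integrable (measure_pmf PX) k" for k :: "_ \<Rightarrow> real"
    by (rule integrable_measure_pmf_finite[OF fin])
  have e0: "\<bar>e0\<bar> = 1"
  proof -
    have "\<bar>sgnb v\<bar> = 1" for v by (simp add: sgnb_def)
    then show ?thesis by (simp add: e0_def abs_mult abs_prod)
  qed
  have sgn: "sgnb (out (mrg x) (2 * K)) * sgnb (pmm_bits p (Suc K) (out (mrg x))) = e0 * h x" for x
  proof -
    have last: "out (mrg x) (2 * K) = out y (2 * K)" using out_last[OF mrg(1)] unfolding mrg(2) .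
    have "(\<Sum>i\<in>I. blk_wt y i (mrg x i)) = (\<Sum>i\<in>I. blk_wt y i (x i))"
      "(\<Prod>i\<in>I. blk_sgn y i (mrg x i)) = (\<Prod>i\<in>I. blk_sgn y i (x i))"
      by (simp_all add: mrg_def)
    then show ?thesis
      unfolding sgnb_pmm_bits[OF K] blk_decomposition[OF mrg(1)] mrg(2) last
      by (simp add: h_def a0_def e0_def Z_def)
  qed
  have ind: "indicator {x. out (mrg x) (2 * K) \<noteq> pmm_bits p (Suc K) (out (mrg x))} x
      = (1 - e0 * h x) / 2" for x
    unfolding sgn[symmetric] by (auto simp: sgnb_def indicator_def)
  have "\<bar>measure_pmf.expectation PX h\<bar> \<le>
      1 / real p + real p * \<rho> ^ card (can_special y - frozen y)"
    unfolding PX_def h_def \<rho>_def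
    by (rule MM_parity_bias) (use p q finite_I blk_sgn_sign blk_wt_varies in \<open>auto simp: can_special_def\<close>)
  also have "\<dots> \<le> 1 / real p + real p * \<rho> ^ M"
  proof -
    have "0 \<le> 1 - 4 * q * (1 - q) / (real p)\<^sup>2" by (rule damping_nonneg) (use p in simp)
    moreover have "0 \<le> 4 * q * (1 - q) / (real p)\<^sup>2" using q by simp
    ultimately have "0 \<le> \<rho>" "\<rho> \<le> 1" by (auto simp: \<rho>_def)
    then show ?thesis using M by (intro add_left_mono mult_left_mono power_decreasing) auto
  qed
  finally have "\<bar>e0 * measure_pmf.expectation PX h\<bar> \<le> 1 / real p + real p * \<rho> ^ M"
    by (simp add: abs_mult e0)
  moreover have "measure_pmf.prob PX {x. out (mrg x) (2 * K) \<noteq> pmm_bits p (Suc K) (out (mrg x))} =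
      (1 - e0 * measure_pmf.expectation PX h) / 2"
  proof -
    have "measure_pmf.prob PX {x. out (mrg x) (2 * K) \<noteq> pmm_bits p (Suc K) (out (mrg x))} =
        measure_pmf.expectation PX (indicator {x. out (mrg x) (2 * K) \<noteq> pmm_bits p (Suc K) (out (mrg x))})"
      by simp
    also have "\<dots> = measure_pmf.expectation PX (\<lambda>x. (1 - e0 * h x) / 2)"
      by (intro Bochner_Integration.integral_cong refl ind)
    also have "\<dots> = (1 - e0 * measure_pmf.expectation PX h) / 2" using int by simp
    finally show ?thesis .
  qed
  ultimately show ?thesis unfolding PX_def \<rho>_def by (simp add: field_simps abs_le_iff)
qed

text \<open>Which case applies depends on the fixed inputs, so a single event T, the union of the
  three tests, has to serve all of them. The target rarely lies in T, while the sampler does with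
  probability almost 1/2 whatever is fixed, apart from \<open>Bad\<close>.\<close>

lemma tv_dist_blocks:
  assumes p: "prime p" "p > 2" "\<And>i. i \<in> I \<Longrightarrow> 2 * card (nbh i) < p"
    and mu: "\<mu> = (\<Sum>i\<in>I. (1/4) ^ card (nbh i))" "\<mu> > 0" "4 * real M \<le> \<mu>"
    and c: "c > 0" and lam: "lam \<ge> 0"
  shows "1/2 - (1 / real p + real p * sqrt (1 - 4 * q * (1 - q) / (real p)\<^sup>2) ^ M) / 2
      - c powr lam * moment lam ^ (l - M) - (1/2) ^ (2 * K) / c - 4 / \<mu>
    \<le> tv_dist (map_pmf out inp) (target_dist p (Suc K))"
proof -
  define \<theta> where "\<theta> = (1 / real p + real p * sqrt (1 - 4 * q * (1 - q) / (real p)\<^sup>2) ^ M) / 2"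
  define Q where "Q = target_dist p (Suc K)"
  define T1 where "T1 = {z. c \<le> pmf (map_pmf out inp) z}"
  define T2 where "T2 = {z. real (card {i \<in> I. special K (nbh i) z}) < \<mu> / 2}"
  define T3 where "T3 = {z. z (2 * K) \<noteq> pmm_bits p (Suc K) z}"
  define T where "T = T1 \<union> T2 \<union> T3"
  \<comment> \<open>Inputs whose output is light in spite of many frozen blocks. Up to this small
    event, the first case lies entirely in T1.\<close>
  define Bad where "Bad = {u. M \<le> card (frozen (rest u)) \<and> pmf (map_pmf out inp) (out u) < c}"
  have rest: "rest = (\<lambda>u i. i \<notin> I \<and> u i)" by (simp add: rest_def fun_eq_iff)

  have "measure_pmf.prob Q T1 \<le> (1/2) ^ (2 * K) / c"
    unfolding T1_def Q_def by (rule prob_heavy_le) (use finite_set_target_dist pmf_target_dist_le c in auto)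
  moreover have "measure_pmf.prob Q T2 \<le> 4 / \<mu>"
    unfolding T2_def Q_def
    by (rule prob_few_special_le) (use finite_I disj mu in \<open>auto simp: nbh_def\<close>)
  moreover have "measure_pmf.prob Q T3 = 0"
  proof -
    have "append_pmm p K -` T3 = {}"
      using pmm_bits_cong[OF _ K, of "append_pmm p K z" z p for z]
      by (auto simp: T3_def append_pmm_def)
    then show ?thesis unfolding Q_def target_dist_eq by simp
  qed
  moreover have "measure_pmf.prob Q T \<le> measure_pmf.prob Q T1 + measure_pmf.prob Q T2 + measure_pmf.prob Q T3"
    unfolding T_def
    using measure_Un_le[of "T1 \<union> T2" "measure_pmf Q" T3] measure_Un_le[of T1 "measure_pmf Q" T2] by simp
  ultimately have QT: "measure_pmf.prob Q T \<le> (1/2) ^ (2 * K) / c + 4 / \<mu>" by linarith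

  define h where "h u = (if M \<le> card (frozen (rest u)) then
      (\<Prod>i\<in>{..<l} - frozen (rest u). pmf (bernoulli_pmf q) (u i) powr - lam) else 0)" for u
  have "measure_pmf.prob inp Bad \<le> c powr lam * measure_pmf.expectation inp h"
    unfolding Bad_def inp_def h_def
    by (rule prob_light_output_le[OF pmf_pos c lam]) (rule out_frozen_invariant)
  moreover have "measure_pmf.expectation inp h \<le> moment lam ^ (l - M)"
    unfolding inp_def h_def rest
    by (rule expectation_inverse_weight_le[OF I(1) _ moment_eq moment_ge_1[OF lam]])
      (auto simp: frozen_def)
  ultimately have bad: "measure_pmf.prob inp Bad \<le> c powr lam * moment lam ^ (l - M)"
    by (meson mult_left_mono order_trans powr_ge_zero)

  define PY where "PY = Pi_pmf ({..<l} - I) False (\<lambda>_. bernoulli_pmf q)"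
  define PX where "PX = Pi_pmf I False (\<lambda>_. bernoulli_pmf q)"
  define mrg where "mrg y x i = (if i \<in> I then x i else y i)" for y x :: "nat \<Rightarrow> bool" and i
  define W where "W = out -` T \<union> Bad"
  have "1/2 - \<theta> \<le> measure_pmf.prob inp W"
  proof -
    have finY: "finite (set_pmf PY)" unfolding PY_def by (intro finite_set_Pi_pmf) auto
    have int: "integrable (measure_pmf PY) k" for k :: "_ \<Rightarrow> real"
      by (rule integrable_measure_pmf_finite[OF finY])
    have "measure_pmf.prob inp W = measure_pmf.expectation inp (indicator W)" by simp
    also have "\<dots> = measure_pmf.expectation PY (\<lambda>y. measure_pmf.expectation PX (\<lambda>x. indicator W (mrg y x)))"
      unfolding inp_def PY_def PX_def mrg_def[abs_def]
      by (rule expectation_Pi_pmf_split) (use I in auto)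
    also have "\<dots> = measure_pmf.expectation PY (\<lambda>y. measure_pmf.prob PX {x. mrg y x \<in> W})"
    proof -
      have "(\<lambda>x. indicator W (mrg y x) :: real) = indicator {x. mrg y x \<in> W}" for y
        by (auto simp: indicator_def)
      then show ?thesis by simp
    qed
    also have "\<dots> \<ge> measure_pmf.expectation PY (\<lambda>y. 1/2 - \<theta>)"
    proof (rule integral_mono_AE[OF int int], unfold AE_measure_pmf_iff, rule ballI)
      fix y assume "y \<in> set_pmf PY"
      then have y: "y \<in> bitstrings l" "\<And>i. i \<in> I \<Longrightarrow> \<not> y i"
        using set_Pi_pmf_subset[of "{..<l} - I" False "\<lambda>_. bernoulli_pmf q"]
        by (auto simp: PY_def bitstrings_def)
      have mrg: "mrg y x \<in> bitstrings l" "rest (mrg y x) = y" for x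
        using y I by (auto simp: mrg_def rest_def bitstrings_def fun_eq_iff)
      have \<theta>0: "\<theta> \<ge> 0" using damping_nonneg[of p q] p by (simp add: \<theta>_def)
      consider "M \<le> card (frozen y)" | "real (card (can_special y)) < \<mu> / 2"
        | "card (frozen y) < M" "\<mu> / 2 \<le> real (card (can_special y))" by linarith
      then show "1/2 - \<theta> \<le> measure_pmf.prob PX {x. mrg y x \<in> W}"
      proof cases
        case 1
        then have "{x. mrg y x \<in> W} = UNIV" using mrg(2)
          by (auto simp: W_def T_def T1_def Bad_def)
        then show ?thesis using \<theta>0 by simp
      next
        case 2
        have "mrg y x \<in> W" for x
          using can_special_ge[OF mrg(1), of x] 2 unfolding mrg(2) by (auto simp: W_def T_def T2_def)
        then have "{x. mrg y x \<in> W} = UNIV" by auto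
        then show ?thesis using \<theta>0 by simp
      next
        case 3
        have "card (can_special y) \<le> card (can_special y - frozen y) + card (frozen y)"
          using finite_I card_Un_le[of "can_special y - frozen y" "frozen y"]
            card_mono[of "(can_special y - frozen y) \<union> frozen y" "can_special y"]
          by (auto simp: can_special_def frozen_def)
        \<comment> \<open>4 M \<le> \<mu> provides 2 M blocks that can be special, of which fewer
          than M are frozen.\<close>
        then have M: "M \<le> card (can_special y - frozen y)" using 3 mu(3) by linarith
        have "1/2 - \<theta> \<le> measure_pmf.prob PX
            {x. out (mrg y x) (2 * K) \<noteq> pmm_bits p (Suc K) (out (mrg y x))}"
          unfolding PX_def \<theta>_def mrg_def[abs_def] by (rule prob_wrong_last_bit_ge[OF y p M])
        also have "\<dots> \<le> measure_pmf.prob PX {x. mrg y x \<in> W}"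
          by (intro measure_pmf.finite_measure_mono) (auto simp: W_def T_def T3_def)
        finally show ?thesis .
      qed
    qed
    finally show ?thesis by simp
  qed
  also have "\<dots> \<le> measure_pmf.prob (map_pmf out inp) T + measure_pmf.prob inp Bad"
    unfolding W_def using measure_Un_le[of "out -` T" "measure_pmf inp" Bad] by simp
  finally have "1/2 - \<theta> - c powr lam * moment lam ^ (l - M) \<le> measure_pmf.prob (map_pmf out inp) T"
    using bad by linarith
  then show ?thesis
    using QT tv_dist_ge[of "map_pmf out inp" T Q] unfolding Q_def \<theta>_def by linarith
qed

end

section \<open>Existence of many inputs with small disjoint blocks\<close>

lemma finite_max_card:
  fixes P :: "'a set \<Rightarrow> bool"
  assumes "finite A" "P {}"
  shows "\<exists>B. B \<subseteq> A \<and> P B \<and> (\<forall>C. C \<subseteq> A \<longrightarrow> P C \<longrightarrow> card C \<le> card B)"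
proof -
  have "\<exists>B. (B \<subseteq> A \<and> P B) \<and> (\<forall>C. C \<subseteq> A \<and> P C \<longrightarrow> card C \<le> card B)"
    by (rule ex_has_greatest_nat[of _ "{}" _ "Suc (card A)"])
      (use assms in \<open>auto intro: card_mono le_imp_less_Suc\<close>)
  then show ?thesis by blast
qed

context local_sampler
begin

text \<open>At most K/4 inputs are read by the last bit or by edges near the root. Counting pairs of
  an input and a vertex in its block leaves at most K/4 others with more than t vertices, so K/2
  good inputs remain. For a disjoint family of maximum size, the block of any other good input meets
  a chosen block, and each chosen block is reached by at most t * (D * (r + 1)) of the inputs
  kept.\<close>

lemma exists_disjoint_blocks:
  assumes D: "\<And>j. j < 2 * K + 1 \<Longrightarrow> card (S j) \<le> D" and r: "8 * D \<le> 2 ^ r"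
    and l: "K \<le> l" and DK: "8 * D \<le> K" and t: "t = 4 * (D * (r + 1))"
  obtains I where "I \<subseteq> {..<l}" "I \<inter> S (2 * K) = {}"
    "\<And>i j. i \<in> I \<Longrightarrow> j \<in> I \<Longrightarrow> i \<noteq> j \<Longrightarrow> nbh i \<inter> nbh j = {}"
    "\<And>i. i \<in> I \<Longrightarrow> card (nbh i) \<le> t"
    "K \<le> 2 * (card I * (1 + t * (D * (r + 1))))"
proof -
  define a where "a = K div 2 ^ r + 1"
  define X where "X = D * (r + 1)"
  define B where "B = S (2 * K) \<union> (\<Union>j\<in>{1..<a}. S (j - 1))"
  define U where "U = {..<l} - B"
  define heavy where "heavy = {i \<in> U. t < card (nbh i)}"
  define good where "good = U - heavy"
  have fS: "finite (S j)" if "j < 2 * K + 1" for j using S[OF that] finite_subset by blast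
  have aK: "a - 1 \<le> K" by (simp add: a_def)
  have "K = K div 2 ^ r * 2 ^ r + K mod 2 ^ r" by (rule div_mult_mod_eq[symmetric])
  moreover have "K mod 2 ^ r < 2 ^ r" by simp
  ultimately have Ka: "K < a * 2 ^ r" unfolding a_def add_mult_distrib by linarith
  have fB: "finite B" unfolding B_def using fS aK by (auto intro!: fS)
  have cB: "4 * card B \<le> K"
  proof -
    have "card (\<Union>j\<in>{1..<a}. S (j - 1)) \<le> (\<Sum>j\<in>{1..<a}. card (S (j - 1)))" by (rule card_UN_le) simp
    also have "\<dots> \<le> (\<Sum>j\<in>{1..<a}. D)" using aK by (intro sum_mono D) auto
    also have "\<dots> = (K div 2 ^ r) * D" by (simp add: a_def)
    finally have "8 * card (\<Union>j\<in>{1..<a}. S (j - 1)) \<le> (K div 2 ^ r) * (8 * D)" by simp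
    also have "\<dots> \<le> (K div 2 ^ r) * 2 ^ r" using r by simp
    also have "\<dots> \<le> K" by (rule div_times_less_eq_dividend)
    finally have "8 * card (\<Union>j\<in>{1..<a}. S (j - 1)) \<le> K" .
    moreover have "card B \<le> card (S (2 * K)) + card (\<Union>j\<in>{1..<a}. S (j - 1))"
      unfolding B_def by (rule card_Un_le)
    moreover have "card (S (2 * K)) \<le> D" by (rule D) simp
    ultimately show ?thesis using DK by linarith
  qed
  have SV: "card (SV m \<inter> U) \<le> X" if m: "m \<in> {1..K}" for m
  proof -
    define J where "J = {j \<in> path_edges m. a \<le> j}"
    have J: "card J \<le> r" unfolding J_def by (rule card_low_path_edges) (use m Ka in auto)
    have Jb: "j - 1 < 2 * K + 1" if "j \<in> J" for j
      using that path_edges_bounds[of j m] m by (auto simp: J_def)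
    have "S (j - 1) \<inter> U = {}" if "j \<in> path_edges m" "\<not> a \<le> j" for j
    proof -
      have "j \<in> {1..<a}" using path_edges_bounds[OF that(1)] that(2) by auto
      then show ?thesis unfolding U_def B_def by blast
    qed
    then have sub: "SV m \<inter> U \<subseteq> S (K - 1 + m) \<union> (\<Union>j\<in>J. S (j - 1))"
      unfolding SV_def J_def by blast
    have fin: "finite (S (K - 1 + m) \<union> (\<Union>j\<in>J. S (j - 1)))"
      using m Jb by (auto simp: J_def intro!: fS)
    have "card (SV m \<inter> U) \<le> card (S (K - 1 + m) \<union> (\<Union>j\<in>J. S (j - 1)))"
      by (rule card_mono[OF fin sub])
    also have "\<dots> \<le> card (S (K - 1 + m)) + card (\<Union>j\<in>J. S (j - 1))" by (rule card_Un_le)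
    also have "card (\<Union>j\<in>J. S (j - 1)) \<le> (\<Sum>j\<in>J. card (S (j - 1)))"
      by (rule card_UN_le) (simp add: J_def)
    also have "\<dots> \<le> (\<Sum>j\<in>J. D)" using Jb by (intro sum_mono D)
    also have "\<dots> = card J * D" by simp
    also have "\<dots> \<le> r * D" using J by simp
    also have "card (S (K - 1 + m)) \<le> D" by (rule D) (use m in auto)
    finally show ?thesis by (simp add: X_def algebra_simps)
  qed
  have heavy: "4 * card heavy \<le> K"
  proof -
    have "(\<Sum>i\<in>U. card (nbh i)) = (\<Sum>i\<in>U. \<Sum>m\<in>{1..K}. if i \<in> SV m then 1 else 0)"
      by (intro sum.cong refl) (simp add: nbh_def sum.If_cases Int_def)
    also have "\<dots> = (\<Sum>m\<in>{1..K}. \<Sum>i\<in>U. if i \<in> SV m then 1 else 0)" by (rule sum.swap)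
    also have "\<dots> = (\<Sum>m\<in>{1..K}. card (SV m \<inter> U))"
      by (intro sum.cong refl) (simp add: U_def sum.If_cases Int_commute)
    also have "\<dots> \<le> (\<Sum>m\<in>{1..K}. X)" by (rule sum_mono) (rule SV)
    finally have "(\<Sum>i\<in>U. card (nbh i)) \<le> K * X" by simp
    moreover have "(\<Sum>i\<in>heavy. t + 1) \<le> (\<Sum>i\<in>heavy. card (nbh i))"
      by (rule sum_mono) (simp add: heavy_def)
    moreover have "(\<Sum>i\<in>heavy. card (nbh i)) \<le> (\<Sum>i\<in>U. card (nbh i))"
      by (rule sum_mono2) (auto simp: U_def heavy_def)
    ultimately have "card heavy * (4 * X + 1) \<le> K * X" by (simp add: t X_def)
    then have *: "4 * card heavy * X + card heavy \<le> K * X" by (simp add: algebra_simps)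
    show ?thesis
    proof (cases "X = 0")
      case True then show ?thesis using * by simp
    next
      case False
      have "4 * card heavy * X \<le> K * X" using * by linarith
      then show ?thesis using False by (simp only: mult_le_cancel2)
    qed
  qed
  have cgood: "K \<le> 2 * card good"
  proof -
    have "l - card B \<le> card U" unfolding U_def using diff_card_le_card_Diff[OF fB, of "{..<l}"] by simp
    moreover have "card U - card heavy \<le> card good"
      unfolding good_def by (rule diff_card_le_card_Diff) (simp add: heavy_def U_def)
    ultimately show ?thesis using cB heavy l by linarith
  qed
  have fgood: "finite good" by (simp add: good_def U_def)
  define P where "P I \<longleftrightarrow> (\<forall>i\<in>I. \<forall>j\<in>I. i \<noteq> j \<longrightarrow> nbh i \<inter> nbh j = {})" for I
  have P0: "P {}" by (simp add: P_def)
  obtain I where I: "I \<subseteq> good" "P I" and max: "\<And>C. C \<subseteq> good \<Longrightarrow> P C \<Longrightarrow> card C \<le> card I"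
    using finite_max_card[of good P, OF fgood P0] by blast
  have fI: "finite I" using I fgood finite_subset by blast
  have It: "card (nbh i) \<le> t" if "i \<in> I" for i using that I(1) by (auto simp: good_def heavy_def)
  have "good \<subseteq> I \<union> (\<Union>i\<in>I. \<Union>m\<in>nbh i. SV m \<inter> U)"
  proof
    fix i assume i: "i \<in> good"
    show "i \<in> I \<union> (\<Union>i\<in>I. \<Union>m\<in>nbh i. SV m \<inter> U)"
    proof (rule ccontr)
      assume no: "\<not> ?thesis"
      have dis: "nbh i \<inter> nbh j = {}" if "j \<in> I" for j
        using no i that by (auto simp: nbh_def good_def)
      have "P (insert i I)" using I(2) dis unfolding P_def by (auto simp: Int_commute)
      then have "card (insert i I) \<le> card I" using i I(1) by (intro max) auto
      then show False using no fI by simp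
    qed
  qed
  then have "card good \<le> card (I \<union> (\<Union>i\<in>I. \<Union>m\<in>nbh i. SV m \<inter> U))"
    using fI by (intro card_mono) (auto simp: nbh_def U_def)
  also have "\<dots> \<le> card I + card (\<Union>i\<in>I. \<Union>m\<in>nbh i. SV m \<inter> U)" by (rule card_Un_le)
  also have "card (\<Union>i\<in>I. \<Union>m\<in>nbh i. SV m \<inter> U) \<le> (\<Sum>i\<in>I. card (\<Union>m\<in>nbh i. SV m \<inter> U))"
    by (rule card_UN_le[OF fI])
  also have "\<dots> \<le> (\<Sum>i\<in>I. t * X)"
  proof (rule sum_mono)
    fix i assume i: "i \<in> I"
    have "card (\<Union>m\<in>nbh i. SV m \<inter> U) \<le> (\<Sum>m\<in>nbh i. card (SV m \<inter> U))"
      by (rule card_UN_le) (simp add: nbh_def)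
    also have "\<dots> \<le> (\<Sum>m\<in>nbh i. X)" by (rule sum_mono, rule SV) (simp add: nbh_def)
    also have "\<dots> \<le> t * X" using It[OF i] by simp
    finally show "card (\<Union>m\<in>nbh i. SV m \<inter> U) \<le> t * X" .
  qed
  finally have "card good \<le> card I * (1 + t * X)" by simp
  then have "K \<le> 2 * (card I * (1 + t * X))" using cgood by linarith
  moreover have "I \<subseteq> {..<l}" "I \<inter> S (2 * K) = {}" using I(1) by (auto simp: good_def U_def B_def)
  ultimately show ?thesis using that[of I] I(2) It unfolding P_def X_def by blast
qed

end

section \<open>Quantitative bounds\<close>

lemma ln_ge_neg_inverse: "0 < x \<Longrightarrow> - ln x \<le> 1 / (x::real)"
  using ln_le_minus_one[of "1 / x"] by (simp add: ln_div)

text \<open>x powr (1 - lam) = x e^z with z = - lam ln x. Since z \<le> lam / \<omega> \<le> 1, the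
  bound e^z \<le> 1 + z + z^2 applies. The linear term is the entropy contribution of x.\<close>

lemma powr_tilt_le:
  fixes x lam \<omega> :: real
  assumes "0 < \<omega>" "\<omega> \<le> x" "x \<le> 1" "0 \<le> lam" "lam \<le> \<omega>"
  shows "x powr (1 - lam) \<le> x + lam * (- x * ln x) + x * (lam / \<omega>)\<^sup>2"
proof -
  define z where "z = lam * (- ln x)"
  have x: "0 < x" using assms by linarith
  have z0: "0 \<le> z" using assms x by (simp add: z_def mult_nonneg_nonpos)
  have "- ln x \<le> 1 / \<omega>"
    using ln_ge_neg_inverse[OF x] assms x by (meson divide_left_mono mult_pos_pos order_trans zero_le_one)
  then have zle: "z \<le> lam / \<omega>" using assms(4) mult_left_mono[of "- ln x" "1 / \<omega>" lam] by (simp add: z_def)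
  then have z1: "z \<le> 1" using assms by (meson divide_le_eq_1_pos order_trans)
  have "x powr (1 - lam) = x * exp z"
    using x by (simp add: powr_def z_def algebra_simps exp_diff)
      (simp add: exp_diff exp_minus field_simps exp_add)
  also have "\<dots> \<le> x * (1 + z + z\<^sup>2)" using exp_bound[OF z0 z1] x by (intro mult_left_mono) auto
  also have "\<dots> \<le> x * (1 + z + (lam / \<omega>)\<^sup>2)" using z0 zle x by (intro mult_left_mono add_left_mono power_mono) auto
  also have "\<dots> = x + lam * (- x * ln x) + x * (lam / \<omega>)\<^sup>2" by (simp add: z_def algebra_simps)
  finally show ?thesis .
qed

section \<open>Moments, entropy and damping as functions of the bias\<close>

context local_sampler
begin

definition ent :: real where
  "ent = - q * ln q - (1 - q) * ln (1 - q)"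

lemma moment_le_exp:
  assumes "0 < \<omega>" "\<omega> \<le> q" "\<omega> \<le> 1 - q" "0 \<le> lam" "lam \<le> \<omega>"
  shows "moment lam \<le> exp (lam * ent + (lam / \<omega>)\<^sup>2)"
proof -
  have "moment lam \<le> (q + lam * (- q * ln q) + q * (lam / \<omega>)\<^sup>2) +
      ((1 - q) + lam * (- (1 - q) * ln (1 - q)) + (1 - q) * (lam / \<omega>)\<^sup>2)"
    unfolding moment_def using assms q by (intro add_mono powr_tilt_le) auto
  also have "\<dots> = 1 + (lam * ent + (lam / \<omega>)\<^sup>2)" by (simp add: ent_def algebra_simps)
  also have "\<dots> \<le> exp (lam * ent + (lam / \<omega>)\<^sup>2)" by (rule exp_ge_add_one_self)
  finally show ?thesis .
qed

text \<open>As the entropy is ln 2 / k, this turns a lower bound on q and 1 - q into an upper bound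
  on k.\<close>

lemma ent_ge:
  assumes "0 < \<omega>" "\<omega> \<le> q" "\<omega> \<le> 1 - q"
  shows "\<omega> * ln 2 \<le> ent"
proof -
  have *: "x * ln 2 \<le> - x * ln x - (1 - x) * ln (1 - x)" if "0 < x" "x \<le> 1/2" for x :: real
  proof -
    have "ln x \<le> ln (1/2)" using that by (subst ln_le_cancel_iff) auto
    then have "ln 2 \<le> - ln x" by (simp add: ln_div)
    then have "x * ln 2 \<le> x * (- ln x)" using that by (intro mult_left_mono) auto
    moreover have "(1 - x) * ln (1 - x) \<le> 0" using that by (intro mult_nonneg_nonpos) auto
    ultimately show ?thesis by simp
  qed
  have "min q (1 - q) * ln 2 \<le> ent"
    using *[of q] *[of "1 - q"] q by (cases "q \<le> 1/2") (auto simp: ent_def min_def algebra_simps)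
  moreover have "\<omega> * ln 2 \<le> min q (1 - q) * ln 2" using assms by (intro mult_right_mono) auto
  ultimately show ?thesis by linarith
qed

lemma moment_half_eq: "moment (1/2) = sqrt q + sqrt (1 - q)"
  using q by (simp add: moment_def powr_half_sqrt)

text \<open>Equality holds for unbiased bits. The bound shows that a source with a large moment must
  have many inputs.\<close>

lemma moment_half_le_sqrt2: "moment (1/2) \<le> sqrt 2"
proof -
  have "(sqrt q + sqrt (1 - q))\<^sup>2 = 1 + 2 * (sqrt q * sqrt (1 - q))"
    using q by (simp add: power2_sum)
  also have "\<dots> \<le> 2"
    using q sum_squares_bound[of "sqrt q" "sqrt (1 - q)"] by simp
  finally show ?thesis unfolding moment_half_eq by (rule real_le_rsqrt)
qed

text \<open>Sharp enough for strongly biased bits: a large moment forces q and 1 - q away from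
  0.\<close>

lemma moment_half_le_exp: "moment (1/2) \<le> exp (sqrt (min q (1 - q)))"
proof -
  have "moment (1/2) \<le> 1 + sqrt (min q (1 - q))"
    unfolding moment_half_eq using q by (auto simp: min_def)
  also have "\<dots> \<le> exp (sqrt (min q (1 - q)))" by (rule exp_ge_add_one_self)
  finally show ?thesis .
qed

lemma damping_le:
  assumes "0 < \<omega>" "\<omega> \<le> q" "\<omega> \<le> 1 - q" "p > 0"
  shows "sqrt (1 - 4 * q * (1 - q) / (real p)\<^sup>2) ^ M \<le> exp (- (real M * \<omega> / (real p)\<^sup>2))"
proof -
  have "\<omega> \<le> 2 * (q * (1 - q))"
  proof (cases "q \<le> 1/2")
    case True
    have "q * 1 \<le> q * (2 * (1 - q))" using True q by (intro mult_left_mono) auto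
    also have "q * (2 * (1 - q)) = 2 * (q * (1 - q))" by simp
    finally show ?thesis by (metis assms(2) mult.right_neutral order_trans)
  next
    case False
    have "(1 - q) * 1 \<le> (1 - q) * (2 * q)" using False q by (intro mult_left_mono) auto
    also have "(1 - q) * (2 * q) = 2 * (q * (1 - q))" by simp
    finally show ?thesis by (metis assms(3) mult.right_neutral order_trans)
  qed
  then have "2 * \<omega> / (real p)\<^sup>2 \<le> 4 * q * (1 - q) / (real p)\<^sup>2" by (intro divide_right_mono) auto
  then have "1 - 4 * q * (1 - q) / (real p)\<^sup>2 \<le> 1 + - (2 * \<omega> / (real p)\<^sup>2)" by linarith
  also have "\<dots> \<le> exp (- (2 * \<omega> / (real p)\<^sup>2))" by (rule exp_ge_add_one_self)
  also have "\<dots> = (exp (- (\<omega> / (real p)\<^sup>2)))\<^sup>2"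
    by (simp add: exp_double[symmetric])
  finally have "sqrt (1 - 4 * q * (1 - q) / (real p)\<^sup>2) \<le> exp (- (\<omega> / (real p)\<^sup>2))"
    by (intro real_le_lsqrt) auto
  then have "sqrt (1 - 4 * q * (1 - q) / (real p)\<^sup>2) ^ M \<le> exp (- (\<omega> / (real p)\<^sup>2)) ^ M"
    using damping_nonneg[OF assms(4), of q] by (intro power_mono) auto
  also have "\<dots> = exp (- (real M * \<omega> / (real p)\<^sup>2))" by (simp add: exp_of_nat_mult[symmetric])
  finally show ?thesis .
qed

lemma tv_dist_large:
  fixes N L \<alpha> \<beta> \<delta> c1 c2 k :: real and D :: nat
  assumes N: "N = real (2 * K)" and L: "L = log 2 N" "1 \<le> L"
    and D: "\<And>j. j < 2 * K + 1 \<Longrightarrow> card (S j) \<le> D" "144 * (real D)\<^sup>2 \<le> (1 - \<beta>) * L"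
    and k: "1 \<le> k" "ent = ln 2 / k" "real l \<le> k * N + N powr \<delta>"
    and p: "prime p" "c1 * N powr \<alpha> \<le> real p" "real p \<le> c2 * N powr \<alpha>"
    and c: "0 < c1" "0 < c2"
    and exps: "\<alpha> < 1/3" "2/3 < \<beta>" "\<beta> < 1" "\<delta> < 1"
    and n1: "16 * L \<le> N" and n2: "2 * N powr \<delta> \<le> N powr \<beta>"
    and n3: "10400 * L\<^sup>2 \<le> N powr ((1 - \<beta>) / 2)" and n4: "73 * L \<le> c1 * N powr \<alpha>"
    and n5: "512 * c2\<^sup>2 * L\<^sup>2 \<le> N powr (\<beta> - 2/3)" and n6: "50000000000 * L ^ 4 \<le> N powr (\<beta> - 1/2)"
    and n7: "256 * L \<le> sqrt N"
  shows "1/2 - (4 + c2) / L \<le> tv_dist (map_pmf out inp) (target_dist p (Suc K))"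
proof -
  have N16: "16 \<le> N" using n1 L(2) by linarith
  have L0: "0 < L" using L by linarith
  have N2L: "2 powr L = N" using N16 by (simp add: L(1))
  have D144: "144 * (real D)\<^sup>2 \<le> L"
  proof -
    have "(1 - \<beta>) * L \<le> 1 * L" using exps L0 by (intro mult_right_mono) auto
    then show ?thesis using D(2) by linarith
  qed
  then have D2: "(real D)\<^sup>2 \<le> L" using zero_le_power2[of "real D"] by linarith
  have DD: "real D \<le> (real D)\<^sup>2" by (cases D) (auto simp: power2_eq_square)
  have small: "2 powr (- y) \<le> 1 / L" if "L \<le> y" for y
  proof -
    have "2 powr (- y) \<le> 2 powr (- L)" using that by simp
    also have "\<dots> = 1 / N" by (simp add: powr_minus_divide N2L)
    also have "\<dots> \<le> 1 / L" using n1 L0 by (intro divide_left_mono) auto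
    finally show ?thesis .
  qed
  have expL: "exp (- y) \<le> 1 / N" if "L \<le> y" for y
  proof -
    have "exp (- y) \<le> exp (- L)" using that by simp
    also have "\<dots> \<le> exp (- (L * ln 2))" using L0 ln_2_less_1 by simp
    also have "\<dots> = 1 / N" using N2L by (simp add: powr_def exp_minus field_simps)
    finally show ?thesis .
  qed
  have NL: "1 / N \<le> 1 / L" using n1 L0 by (intro divide_left_mono) auto
  have halfN: "(1/2) ^ (2 * K) = 2 powr (- N)"
  proof -
    have "2 powr (- N) = 1 / 2 powr (real (2 * K))" by (simp add: N powr_minus_divide)
    also have "\<dots> = 1 / 2 ^ (2 * K)" by (subst powr_realpow) auto
    finally show ?thesis by (simp add: power_divide)
  qed
  define R where "R = (\<Union>j<2 * K + 1. S j)"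
  have Rl: "card R \<le> l"
    using card_mono[of "{..<l}" R] S unfolding R_def by (metis UN_least card_lessThan finite_lessThan lessThan_iff)
  have RD: "real (card R) \<le> 2 * N * real D"
  proof -
    have "card R \<le> (\<Sum>j<2 * K + 1. card (S j))" unfolding R_def by (rule card_UN_le) simp
    also have "\<dots> \<le> (\<Sum>j<2 * K + 1. D)" by (intro sum_mono D) auto
    finally have "card R \<le> (2 * K + 1) * D" by simp
    then have "real (card R) \<le> real ((2 * K + 1) * D)" by (rule of_nat_mono)
    also have "\<dots> = (N + 1) * real D" by (simp add: N algebra_simps)
    also have "\<dots> \<le> (2 * N) * real D" using N16 by (intro mult_right_mono) auto
    finally show ?thesis .
  qed
  show ?thesis
  \<comment> \<open>In the first case the inputs that are read carry so little entropy that heavy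
    outputs alone separate the distributions. In the second the failed inequality yields both K
    \<le> l and a lower bound on q and 1 - q.\<close>
  proof (cases "moment (1/2) ^ card R \<le> 2 powr (N / 4)")
    case True
    \<comment> \<open>The exponent 3/4 leaves both errors exponentially small: 2^(-3N/8) * 2^(N/4) =
      2^(-N/8) and 2^(-N) / cc = 2^(-N/4).\<close>
    define cc where "cc = 2 powr (- (3 * N / 4))"
    have "1 - cc powr (1/2) * moment (1/2) ^ card R - (1/2) ^ (2 * K) / cc
        \<le> tv_dist (map_pmf out inp) (target_dist p (Suc K))"
      unfolding R_def by (rule tv_dist_low_entropy) (simp add: cc_def)
    moreover have "cc powr (1/2) * moment (1/2) ^ card R \<le> 1 / L"
    proof -
      have "cc powr (1/2) * moment (1/2) ^ card R \<le> cc powr (1/2) * 2 powr (N / 4)"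
        using True by (intro mult_left_mono) auto
      also have "\<dots> = 2 powr (- (N / 8))"
        unfolding cc_def powr_powr powr_add[symmetric] by simp
      also have "\<dots> \<le> 1 / L" using n1 L0 by (intro small) linarith
      finally show ?thesis .
    qed
    moreover have "(1/2) ^ (2 * K) / cc \<le> 1 / L"
    proof -
      have "(1/2) ^ (2 * K) / cc = 2 powr (- (N / 4))"
        unfolding halfN cc_def powr_diff[symmetric] by simp
      also have "\<dots> \<le> 1 / L" using n1 L0 by (intro small) linarith
      finally show ?thesis .
    qed
    moreover have "(4 + c2) / L \<ge> 2 / L" using c L0 by (intro divide_right_mono) auto
    moreover have "2 / L = 1 / L + 1 / L" by simp
    ultimately show ?thesis by linarith
  next
    case False
    then have mR: "2 powr (N / 4) < moment (1/2) ^ card R" by simp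
    have m0: "0 \<le> moment (1/2)" using moment_ge_1[of "1/2"] by simp
    have "K \<le> l"
    proof -
      have "2 powr (N / 4) < sqrt 2 ^ card R"
        using mR power_mono[OF moment_half_le_sqrt2 m0, of "card R"] by linarith
      also have "sqrt 2 ^ card R = 2 powr (real (card R) / 2)"
        by (simp add: powr_half_sqrt[symmetric] powr_realpow[symmetric] powr_powr)
      finally have "N / 4 < real (card R) / 2" by simp
      then show ?thesis using Rl by (simp add: N)
    qed
    \<comment> \<open>The failed inequality will give D * s > 1/16 with s^2 = min q (1 - q). As D^2
      \<le> L, squaring produces the constant 256 and the factor L.\<close>
    define \<omega> where "\<omega> = 1 / (256 * L)"
    define s where "s = sqrt (min q (1 - q))"
    have s2: "s\<^sup>2 = min q (1 - q)" using q by (simp add: s_def)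
    have s0: "0 \<le> s" using q by (simp add: s_def)
    have "1/16 < real D * s"
    proof -
      have "exp (N / 4 * ln 2) < exp s ^ card R"
        using mR power_mono[OF moment_half_le_exp m0, of "card R"] by (simp add: powr_def s_def)
      also have "\<dots> = exp (real (card R) * s)" by (simp add: exp_of_nat_mult)
      finally have "N / 4 * ln 2 < real (card R) * s" by simp
      also have "\<dots> \<le> (2 * N * real D) * s" using RD s0 by (rule mult_right_mono)
      finally have "N * (ln 2 / 4) < N * (2 * (real D * s))" by (simp add: algebra_simps)
      then have "ln 2 / 4 < 2 * (real D * s)" using N16 by simp
      then show ?thesis using ln2_ge_two_thirds by linarith
    qed
    then have "(1/16)\<^sup>2 < (real D * s)\<^sup>2" by (intro power_strict_mono) auto
    also have "\<dots> = (real D)\<^sup>2 * s\<^sup>2" by (simp add: power_mult_distrib)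
    also have "\<dots> \<le> L * s\<^sup>2" using D2 by (intro mult_right_mono) auto
    finally have lt: "(1/16)\<^sup>2 < L * s\<^sup>2" .
    have "\<omega> = (1/16)\<^sup>2 / L" by (simp add: \<omega>_def power2_eq_square)
    also have "\<dots> < s\<^sup>2" using lt L0 by (simp add: pos_divide_less_eq mult.commute)
    finally have "\<omega> \<le> min q (1 - q)" unfolding s2 by simp
    then have \<omega>: "0 < \<omega>" "\<omega> \<le> q" "\<omega> \<le> 1 - q" using L0 by (auto simp: \<omega>_def)
    define h where "h = 1 / k"
    have h: "ent = h * ln 2" "h * k = 1" "0 < h" "h \<le> 1" using k by (auto simp: h_def)
    have \<omega>h: "\<omega> \<le> h" using ent_ge[OF \<omega>] by (simp add: h(1))
    have kL: "k \<le> 256 * L"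
    proof -
      have "1 / h \<le> 1 / \<omega>" using \<omega>h \<omega> h by (intro divide_left_mono) auto
      then show ?thesis by (simp add: h_def \<omega>_def)
    qed
    have Ngt1: "1 < N" using N16 by simp

    \<comment> \<open>The depth is r = 8 D, a crude way to meet 8 D \<le> 2^r; it makes t at most 36
      D^2.\<close>
    define t where "t = 4 * (D * (8 * D + 1))"
    have D8: "8 * D \<le> 2 ^ (8 * D)" by (simp add: less_imp_le)
    have DK: "8 * D \<le> K"
    proof -
      have "16 * L \<le> 2 * real K" using n1 by (simp add: N)
      then have "8 * real D \<le> real K" using D144 DD L0 by linarith
      then show ?thesis by linarith
    qed
    obtain I where I: "I \<subseteq> {..<l}" "I \<inter> S (2 * K) = {}"
      "\<And>i j. i \<in> I \<Longrightarrow> j \<in> I \<Longrightarrow> i \<noteq> j \<Longrightarrow> nbh i \<inter> nbh j = {}"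
      and It: "\<And>i. i \<in> I \<Longrightarrow> card (nbh i) \<le> t"
      and Ic: "K \<le> 2 * (card I * (1 + t * (D * (8 * D + 1))))"
      using exists_disjoint_blocks[OF D(1) D8 \<open>K \<le> l\<close> DK t_def] by blast
    interpret local_sampler_blocks l K q f S I by unfold_locales (use I in auto)
    have X9: "real (D * (8 * D + 1)) \<le> 9 * (real D)\<^sup>2"
    proof -
      have "real (D * (8 * D + 1)) = 8 * (real D)\<^sup>2 + real D" by (simp add: power2_eq_square algebra_simps)
      then show ?thesis using DD by linarith
    qed
    have t36: "real t \<le> 36 * (real D)\<^sup>2" using X9 by (simp add: t_def)
    define M where "M = nat \<lceil>N powr \<beta>\<rceil>"
    have Nb1: "1 \<le> N powr \<beta>" using N16 exps by (intro ge_one_powr_ge_zero) auto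
    have M: "N powr \<beta> \<le> real M" "real M \<le> 2 * N powr \<beta>" using Nb1 unfolding M_def by linarith+
    define \<mu> where "\<mu> = (\<Sum>i\<in>I. (1/4) ^ card (nbh i) :: real)"
    have \<mu>4: "4 * real M \<le> \<mu>"
    proof -
      \<comment> \<open>N^\<beta> * Y * Y = N: one factor Y pays for 4^t, the other for the
        polylogarithmic loss in the choice of blocks.\<close>
      define Y where "Y = N powr ((1 - \<beta>) / 2)"
      have Y0: "0 < Y" using N16 by (simp add: Y_def)
      have "4 ^ t = 2 powr (real (2 * t))" by (subst powr_realpow) (auto simp: power_mult)
      also have "\<dots> \<le> 2 powr ((1 - \<beta>) / 2 * L)" using t36 D(2) by simp
      also have "\<dots> = (2 powr L) powr ((1 - \<beta>) / 2)" by (simp add: powr_powr mult.commute)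
      also have "\<dots> = Y" unfolding N2L Y_def ..
      finally have four: "4 ^ t \<le> Y" .
      have "1 + real t * real (D * (8 * D + 1)) \<le> 325 * L\<^sup>2"
      proof -
        have "real t * real (D * (8 * D + 1)) \<le> (36 * (real D)\<^sup>2) * (9 * (real D)\<^sup>2)"
          using X9 t36 by (intro mult_mono) auto
        also have "\<dots> \<le> (36 * L) * (9 * L)" using D2 L0 by (intro mult_mono) auto
        finally have "real t * real (D * (8 * D + 1)) \<le> 324 * L\<^sup>2" by (simp add: power2_eq_square)
        moreover have "1 \<le> L\<^sup>2" using L(2) by (simp add: one_le_power)
        ultimately show ?thesis by linarith
      qed
      then have "real (card I) * (1 + real t * real (D * (8 * D + 1))) \<le> real (card I) * (325 * L\<^sup>2)"
        by (intro mult_left_mono) auto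
      moreover have "real K \<le> real (2 * (card I * (1 + t * (D * (8 * D + 1)))))" using Ic by (rule of_nat_mono)
      ultimately have Ncard: "N \<le> 1300 * L\<^sup>2 * real (card I)" by (simp add: N algebra_simps)
      have "real (card I) / 4 ^ t = (\<Sum>i\<in>I. (1/4) ^ t)" by (simp add: power_divide)
      also have "\<dots> \<le> \<mu>" unfolding \<mu>_def using It by (intro sum_mono power_decreasing) auto
      finally have "real (card I) / 4 ^ t \<le> \<mu>" .
      then have "real (card I) \<le> \<mu> * 4 ^ t" by (simp add: field_simps)
      also have "\<dots> \<le> \<mu> * Y"
        using four by (intro mult_left_mono) (auto simp: \<mu>_def intro!: sum_nonneg)
      finally have cI: "real (card I) \<le> \<mu> * Y" .
      have \<mu>0: "0 \<le> \<mu>" by (auto simp: \<mu>_def intro!: sum_nonneg)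
      have "N powr \<beta> * Y * Y = N"
        using N16 by (simp add: Y_def powr_add[symmetric])
      then have "8 * N powr \<beta> * Y * Y = 8 * N" by simp
      also have "\<dots> \<le> 8 * (1300 * L\<^sup>2 * (\<mu> * Y))"
        using order_trans[OF Ncard mult_left_mono[OF cI, of "1300 * L\<^sup>2"]] by (simp add: algebra_simps)
      also have "\<dots> = (10400 * L\<^sup>2) * (\<mu> * Y)" by simp
      also have "\<dots> \<le> Y * (\<mu> * Y)" using n3 \<mu>0 Y0 unfolding Y_def[symmetric] by (intro mult_right_mono) auto
      finally have "(8 * N powr \<beta>) * (Y * Y) \<le> \<mu> * (Y * Y)" by (simp add: algebra_simps)
      then have "8 * N powr \<beta> \<le> \<mu>" using Y0 by simp
      then show ?thesis using M by linarith
    qed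
    have Nb: "50000000000 * L ^ 4 \<le> N powr \<beta>"
      using n6 powr_mono[of "\<beta> - 1/2" \<beta> N] Ngt1 by linarith
    have L24: "L \<le> L\<^sup>2" "L\<^sup>2 \<le> L ^ 4" "L \<le> L ^ 3"
      using L(2) power_increasing[of 1 2 L] power_increasing[of 2 4 L] power_increasing[of 1 3 L] by auto
    have \<mu>L: "4 / \<mu> \<le> 1 / L"
    proof -
      have "4 * L \<le> \<mu>" using Nb L24 \<mu>4 M L0 by linarith
      then show ?thesis using L0 by (simp add: field_simps)
    qed
    have \<mu>0: "0 < \<mu>" using \<mu>4 M Nb1 by linarith
    have Ml: "M \<le> l"
    proof -
      have "\<mu> \<le> (\<Sum>i\<in>I. 1)" unfolding \<mu>_def by (intro sum_mono power_le_one) auto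
      moreover have "card I \<le> l" using card_mono[OF _ I(1)] by simp
      ultimately show ?thesis using \<mu>4 by simp
    qed
    have p72: "72 * L < real p" using n4 p(2) L0 by linarith
    have p2: "p > 2" using p72 L(2) by linarith
    have pI: "2 * card (nbh i) < p" if "i \<in> I" for i
    proof -
      have "2 * real (card (nbh i)) \<le> 72 * (real D)\<^sup>2" using It[OF that] t36 by linarith
      then show ?thesis using D2 p72 by linarith
    qed

    \<comment> \<open>The M lost inputs gain about lam * M / k in the exponent, against a quadratic
      error of order l * (lam / \<omega>)^2. With this tilt the gain is N^(\<beta> - 1/2) up to
      logarithms and the error only of order L^3.\<close>
    define lam where "lam = 1 / sqrt N"
    \<comment> \<open>M frozen inputs cost M h bits of entropy, half of which absorbs the surplus
      N^\<delta>. What remains is at most N - M h / 2, and the threshold lies midway between this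
      and N.\<close>
    define X where "X = N - real M * h / 4"
    define cc where "cc = 2 powr (- X)"
    have cc0: "0 < cc" unfolding cc_def by simp
    have sN: "0 < sqrt N" "sqrt N * sqrt N = N" using N16 by auto
    have lam: "0 \<le> lam" "lam \<le> \<omega>"
      using n7 L0 sN by (auto simp: lam_def \<omega>_def intro!: divide_left_mono)
    have lamo: "(lam / \<omega>)\<^sup>2 = 65536 * L\<^sup>2 / N"
      using sN L0 N16 by (simp add: lam_def \<omega>_def power_divide power_mult_distrib)
    \<comment> \<open>24000000 exceeds the error constant 257 * 65536 = 16842752 with room for an
      extra L. The factor 2048 = 2 * 4 * 256 collects a bound 1/2 for ln 2, the quarter and
      \<omega>.\<close>
    have gap: "24000000 * L ^ 3 \<le> lam * ln 2 * (real M * h / 4)"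
    proof -
      have "24000000 * L ^ 3 * (2048 * L) \<le> 50000000000 * L ^ 4"
        using L0 by (simp add: power_numeral_reduce mult.assoc)
      also note n6
      also have "N powr (\<beta> - 1/2) = N powr \<beta> * lam"
        using N16 by (simp add: powr_diff lam_def powr_half_sqrt)
      finally have "24000000 * L ^ 3 \<le> N powr \<beta> * lam / (2048 * L)" using L0 by (simp add: field_simps)
      also have "\<dots> = lam * (1/2) * (N powr \<beta> * \<omega> / 4)" by (simp add: \<omega>_def)
      also have "\<dots> \<le> lam * ln 2 * (real M * h / 4)"
        using lam \<omega> \<omega>h M ln2_ge_two_thirds by (intro mult_mono divide_right_mono) auto
      finally show ?thesis .
    qed
    have light: "cc powr lam * moment lam ^ (l - M) \<le> 1 / L"
    proof -
      have rlM: "real (l - M) = real l - real M" using Ml by simp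
      have "moment lam ^ (l - M) \<le> exp (lam * ent + (lam / \<omega>)\<^sup>2) ^ (l - M)"
        using moment_le_exp[OF \<omega> lam] moment_ge_1[OF lam(1)] by (intro power_mono) auto
      also have "\<dots> = exp (real (l - M) * (lam * ent + (lam / \<omega>)\<^sup>2))" by (simp add: exp_of_nat_mult)
      finally have mom: "moment lam ^ (l - M) \<le> exp (real (l - M) * (lam * ent + (lam / \<omega>)\<^sup>2))" .
      have "cc powr lam = exp (- (lam * ln 2 * X))" by (simp add: cc_def powr_powr powr_def)
      then have "cc powr lam * moment lam ^ (l - M) \<le>
          exp (- (lam * ln 2 * X)) * exp (real (l - M) * (lam * ent + (lam / \<omega>)\<^sup>2))"
        using mom by (simp add: mult_left_mono)
      also have "exp (- (lam * ln 2 * X)) * exp (real (l - M) * (lam * ent + (lam / \<omega>)\<^sup>2)) =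
          exp (- (lam * ln 2 * X) + real (l - M) * (lam * ent + (lam / \<omega>)\<^sup>2))" by (rule exp_add[symmetric])
      also have "\<dots> \<le> exp (- L)"
      proof -
        have "(real l - real M) * h \<le> (k * N + N powr \<delta> - real M) * h"
          using k(3) h by (intro mult_right_mono) auto
        also have "\<dots> \<le> (k * N - real M / 2) * h" using n2 M h by (intro mult_right_mono) auto
        also have "\<dots> = N - real M * h / 2" using h(2) by (simp add: algebra_simps)
        finally have "lam * ln 2 * ((real l - real M) * h) \<le> lam * ln 2 * (N - real M * h / 2)"
          using lam by (intro mult_left_mono) auto
        then have e1: "real (l - M) * (lam * ent) \<le> lam * ln 2 * X - lam * ln 2 * (real M * h / 4)"
          unfolding rlM h(1) X_def by (simp add: algebra_simps)
        have "real l \<le> 257 * L * N"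
        proof -
          have "N powr \<delta> \<le> N powr 1" using N16 exps by (intro powr_mono) auto
          then have "N powr \<delta> \<le> 1 * N" using N16 by simp
          also have "\<dots> \<le> L * N" using L(2) N16 by (intro mult_right_mono) auto
          finally have "N powr \<delta> \<le> L * N" .
          moreover have "k * N \<le> 256 * L * N" using kL N16 by (intro mult_right_mono) auto
          ultimately show ?thesis using k(3) by linarith
        qed
        then have "real (l - M) \<le> 257 * L * N" using rlM by linarith
        then have "real (l - M) * (lam / \<omega>)\<^sup>2 \<le> 257 * L * N * (65536 * L\<^sup>2 / N)"
          unfolding lamo using N16 by (intro mult_right_mono) auto
        also have "\<dots> = 16842752 * L ^ 3" using N16 by (simp add: power_numeral_reduce)
        finally have "- (lam * ln 2 * X) + real (l - M) * (lam * ent + (lam / \<omega>)\<^sup>2) \<le>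
            16842752 * L ^ 3 - 24000000 * L ^ 3"
          using e1 gap by (simp add: distrib_left)
        also have "\<dots> \<le> - L" using L24 L0 by linarith
        finally show ?thesis by simp
      qed
      also have "\<dots> \<le> 1 / L" using expL[of L] NL by simp
      finally show ?thesis .
    qed
    have heavy: "(1/2) ^ (2 * K) / cc \<le> 1 / L"
    proof -
      have "(1/2) ^ (2 * K) / cc = 2 powr (- (real M * h / 4))"
        unfolding halfN cc_def powr_diff[symmetric] by (simp add: X_def)
      also have "\<dots> \<le> 1 / L"
      proof (rule small)
        have "1024 * L\<^sup>2 \<le> N powr \<beta>" using Nb L24 L0 by linarith
        then have "1024 * L * L \<le> N powr \<beta>" by (simp add: power2_eq_square)
        then have "L \<le> N powr \<beta> * \<omega> / 4" using L0 by (simp add: \<omega>_def field_simps)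
        also have "\<dots> \<le> real M * h / 4" using M \<omega>h \<omega> by (intro divide_right_mono mult_mono) auto
        finally show "L \<le> real M * h / 4" .
      qed
      finally show ?thesis .
    qed
    have damp: "real p * sqrt (1 - 4 * q * (1 - q) / (real p)\<^sup>2) ^ M \<le> c2 / L"
    proof -
      \<comment> \<open>Here \<alpha> < 1/3 enters: p^2 is of order at most N^(2/3), below M by a
        power of N that absorbs the logarithms.\<close>
      have "(real p)\<^sup>2 \<le> (c2 * N powr \<alpha>)\<^sup>2" using p(3) by (intro power_mono) auto
      also have "\<dots> = c2\<^sup>2 * N powr (2 * \<alpha>)" using N16
        by (simp add: power_mult_distrib powr_power)
      also have "\<dots> \<le> c2\<^sup>2 * N powr (2/3)" using exps Ngt1 by (intro mult_left_mono powr_mono) auto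
      finally have pp: "(real p)\<^sup>2 \<le> c2\<^sup>2 * N powr (2/3)" .
      have "2 * L * (c2\<^sup>2 * N powr (2/3)) * (256 * L) = (512 * c2\<^sup>2 * L\<^sup>2) * N powr (2/3)"
        by (simp add: power2_eq_square)
      also have "\<dots> \<le> N powr (\<beta> - 2/3) * N powr (2/3)" using n5 by (intro mult_right_mono) auto
      also have "\<dots> = N powr \<beta>" by (simp add: powr_add[symmetric])
      finally have "2 * L * (c2\<^sup>2 * N powr (2/3)) \<le> N powr \<beta> * \<omega>" using L0 by (simp add: \<omega>_def field_simps)
      moreover have "2 * L * (real p)\<^sup>2 \<le> 2 * L * (c2\<^sup>2 * N powr (2/3))" using pp L0 by (intro mult_left_mono) auto
      moreover have "N powr \<beta> * \<omega> \<le> real M * \<omega>" using M \<omega> by (intro mult_right_mono) auto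
      ultimately have "2 * L * (real p)\<^sup>2 \<le> real M * \<omega>" by linarith
      then have ex: "2 * L \<le> real M * \<omega> / (real p)\<^sup>2" using p2 by (simp add: pos_le_divide_eq)
      have "sqrt (1 - 4 * q * (1 - q) / (real p)\<^sup>2) ^ M \<le> exp (- (real M * \<omega> / (real p)\<^sup>2))"
        by (rule damping_le[OF \<omega>]) (use p2 in simp)
      also have "\<dots> \<le> exp (- (2 * L))" using ex by simp
      \<comment> \<open>One factor cancels the prefactor p \<le> c2 N, the other supplies
        1/L.\<close>
      also have "\<dots> = exp (- L) * exp (- L)" by (simp add: exp_add[symmetric])
      also have "\<dots> \<le> 1 / N * (1 / L)" using expL[of L] NL N16 by (intro mult_mono) auto
      finally have "real p * sqrt (1 - 4 * q * (1 - q) / (real p)\<^sup>2) ^ M \<le> (c2 * N) * (1 / N * (1 / L))"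
      proof (rule mult_mono[rotated])
        have "N powr \<alpha> \<le> N powr 1" using exps Ngt1 by (intro powr_mono) auto
        then have "c2 * N powr \<alpha> \<le> c2 * N" using c N16 by (intro mult_left_mono) auto
        then show "real p \<le> c2 * N" using p(3) by linarith
      qed (use c N16 damping_nonneg[of p q] p2 in auto)
      also have "\<dots> = c2 / L" using N16 by simp
      finally show ?thesis .
    qed
    have pL: "1 / real p \<le> 1 / L" using p72 L0 by (intro divide_left_mono) auto
    have "1/2 - (1 / real p + real p * sqrt (1 - 4 * q * (1 - q) / (real p)\<^sup>2) ^ M) / 2
        - cc powr lam * moment lam ^ (l - M) - (1/2) ^ (2 * K) / cc - 4 / \<mu>
      \<le> tv_dist (map_pmf out inp) (target_dist p (Suc K))"
      by (rule tv_dist_blocks[OF p(1) p2 pI \<mu>_def \<mu>0 \<mu>4 cc0 lam(1)])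
    moreover have "(4 + c2) / L = 4 * (1 / L) + c2 / L" by (simp add: add_divide_distrib)
    moreover have "0 \<le> c2 / L" "0 \<le> 1 / L" using c L0 by auto
    ultimately show ?thesis using damp pL light heavy \<mu>L by argo
  qed
qed

end

section \<open>Asymptotics and choice of constants\<close>

lemma eventually_log_pow4_le_powr:
  fixes A e :: real
  assumes "e > 0"
  shows "\<forall>\<^sub>F n in sequentially. A * log 2 (real (2 * n - 2)) ^ 4 \<le> real (2 * n - 2) powr e"
proof -
  have "((\<lambda>x. A * log 2 x ^ 4 / x powr e) \<longlongrightarrow> 0) at_top" using assms by real_asymp
  then have "\<forall>\<^sub>F x in at_top. A * log 2 x ^ 4 / x powr e < 1" by (rule order_tendstoD) simp
  then have "\<forall>\<^sub>F x in at_top. A * log 2 x ^ 4 \<le> x powr e"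
    using eventually_gt_at_top[of 0] by eventually_elim (simp add: divide_less_eq)
  moreover have "filterlim (\<lambda>n. real (2 * n - 2)) at_top sequentially" by real_asymp
  ultimately show ?thesis by (rule eventually_compose_filterlim)
qed

theorem theoremC2:
  "\<forall>\<delta>::real. 0 \<le> \<delta> \<and> \<delta> < 1 \<longrightarrow>
   (\<forall>\<alpha>::real. \<delta>/3 < \<alpha> \<and> \<alpha> < 1/3 \<longrightarrow>
   (\<exists>\<epsilon>::real. \<epsilon> > 0 \<and>
   (\<forall>c1 c2::real. 0 < c1 \<and> c1 \<le> c2 \<longrightarrow>
   (\<exists>C::real. C > 0 \<and> (\<exists>n0::nat. \<forall>n\<ge>n0.
     (let N = 2*n - 2 in
      \<forall>(p::nat) (k::real) (b::real) (l::nat) f.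
        prime p \<and> c1 * real N powr \<alpha> \<le> real p \<and> real p \<le> c2 * real N powr \<alpha> \<and>
        k \<ge> 1 \<and> -1/2 \<le> b \<and> b \<le> 1/2 \<and> binH b = 1/k \<and>
        real l \<le> k * real N + real N powr \<delta> \<and>
        is_local (sqrt (\<epsilon> * log 2 (real N))) l (N+1) f
        \<longrightarrow> tv_dist (push (N+1) f (Bern_pow b l)) (target_dist p n)
              \<ge> 1/2 - C / log 2 (real N)))))))"
proof (intro allI impI, elim conjE)
  fix \<delta> \<alpha> :: real
  assume \<delta>: "0 \<le> \<delta>" "\<delta> < 1" and \<alpha>: "\<delta>/3 < \<alpha>" "\<alpha> < 1/3"
  \<comment> \<open>The midpoint between max \<delta> (2/3) and 1.\<close>
  define \<beta> where "\<beta> = (1 + max \<delta> (2/3)) / 2"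
  \<comment> \<open>Chosen so that 4^t \<le> 2^(72 D^2) \<le> N^((1 - \<beta>)/2) for D^2 \<le>
    \<epsilon> L.\<close>
  define \<epsilon> where "\<epsilon> = (1 - \<beta>) / 144"
  have \<beta>: "2/3 < \<beta>" "\<beta> < 1" "\<delta> < \<beta>" using \<delta> by (auto simp: \<beta>_def max_def)
  have \<alpha>0: "0 < \<alpha>" using \<alpha> \<delta> by linarith
  show "\<exists>\<epsilon>>0. \<forall>c1 c2. 0 < c1 \<and> c1 \<le> c2 \<longrightarrow> (\<exists>C>0. \<exists>n0. \<forall>n\<ge>n0. let N = 2 * n - 2 in
      \<forall>p k b l f. prime p \<and> c1 * real N powr \<alpha> \<le> real p \<and> real p \<le> c2 * real N powr \<alpha> \<and>
        1 \<le> k \<and> -1/2 \<le> b \<and> b \<le> 1/2 \<and> binH b = 1/k \<and> real l \<le> k * real N + real N powr \<delta> \<and>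
        is_local (sqrt (\<epsilon> * log 2 (real N))) l (N + 1) f \<longrightarrow>
        1/2 - C / log 2 (real N) \<le> tv_dist (push (N + 1) f (Bern_pow b l)) (target_dist p n))"
  proof (rule exI[of _ \<epsilon>], intro conjI allI impI, goal_cases)
    case 1
    show ?case using \<beta> by (simp add: \<epsilon>_def)
  next
    case (2 c1 c2)
    then have c: "0 < c1" "0 < c2" by auto
    \<comment> \<open>The fourth power stands in for every power of L that occurs, as L \<ge>
      1.\<close>
    have "\<forall>\<^sub>F n in sequentially. 2 \<le> n \<and>
        16 * log 2 (real (2 * n - 2)) ^ 4 \<le> real (2 * n - 2) powr 1 \<and>
        2 * log 2 (real (2 * n - 2)) ^ 4 \<le> real (2 * n - 2) powr (\<beta> - \<delta>) \<and>
        10400 * log 2 (real (2 * n - 2)) ^ 4 \<le> real (2 * n - 2) powr ((1 - \<beta>) / 2) \<and>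
        73 / c1 * log 2 (real (2 * n - 2)) ^ 4 \<le> real (2 * n - 2) powr \<alpha> \<and>
        512 * c2\<^sup>2 * log 2 (real (2 * n - 2)) ^ 4 \<le> real (2 * n - 2) powr (\<beta> - 2/3) \<and>
        50000000000 * log 2 (real (2 * n - 2)) ^ 4 \<le> real (2 * n - 2) powr (\<beta> - 1/2) \<and>
        256 * log 2 (real (2 * n - 2)) ^ 4 \<le> real (2 * n - 2) powr (1/2)"
      using \<beta> \<alpha>0 by (intro eventually_conj eventually_log_pow4_le_powr eventually_ge_at_top) auto
    then obtain n0 where n0: "\<And>n. n \<ge> n0 \<Longrightarrow> 2 \<le> n \<and>
        16 * log 2 (real (2 * n - 2)) ^ 4 \<le> real (2 * n - 2) powr 1 \<and>
        2 * log 2 (real (2 * n - 2)) ^ 4 \<le> real (2 * n - 2) powr (\<beta> - \<delta>) \<and>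
        10400 * log 2 (real (2 * n - 2)) ^ 4 \<le> real (2 * n - 2) powr ((1 - \<beta>) / 2) \<and>
        73 / c1 * log 2 (real (2 * n - 2)) ^ 4 \<le> real (2 * n - 2) powr \<alpha> \<and>
        512 * c2\<^sup>2 * log 2 (real (2 * n - 2)) ^ 4 \<le> real (2 * n - 2) powr (\<beta> - 2/3) \<and>
        50000000000 * log 2 (real (2 * n - 2)) ^ 4 \<le> real (2 * n - 2) powr (\<beta> - 1/2) \<and>
        256 * log 2 (real (2 * n - 2)) ^ 4 \<le> real (2 * n - 2) powr (1/2)"
      unfolding eventually_sequentially by blast
    show ?case
    \<comment> \<open>The errors from 1/p, light outputs, heavy outputs and 4/\<mu> are at most 1/L
      each; the nontrivial characters contribute at most c2/L.\<close>
    proof (intro exI[of _ "4 + c2"] conjI exI[of _ n0] allI impI, goal_cases)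
      case 1
      show ?case using c by simp
    next
      case (2 n)
      define K where "K = n - 1"
      define N where "N = real (2 * K)"
      define L where "L = log 2 N"
      have n: "2 \<le> n" "n = Suc K" "2 * n - 2 = 2 * K" "K \<ge> 1" using n0[OF 2] by (auto simp: K_def)
      have N2: "2 \<le> N" using n(4) by (simp add: N_def)
      have L1: "1 \<le> L" using N2 by (simp add: L_def le_log_iff)
      have pows: "L \<le> L ^ 4" "L\<^sup>2 \<le> L ^ 4" "1 \<le> L ^ 4"
        using L1 power_increasing[of 1 4 L] power_increasing[of 2 4 L] by (auto simp: one_le_power)
      note ev = n0[OF 2, unfolded n(3) N_def[symmetric] L_def[symmetric]]
      have n1: "16 * L \<le> N" using ev pows N2 by simp
      have n2: "2 * N powr \<delta> \<le> N powr \<beta>"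
      proof -
        have "2 * N powr \<delta> \<le> N powr (\<beta> - \<delta>) * N powr \<delta>" using ev pows by (intro mult_right_mono) auto
        then show ?thesis by (simp add: powr_add[symmetric])
      qed
      have n3: "10400 * L\<^sup>2 \<le> N powr ((1 - \<beta>) / 2)" using ev pows by linarith
      have n4: "73 * L \<le> c1 * N powr \<alpha>"
      proof -
        have "73 / c1 * L \<le> 73 / c1 * L ^ 4" using pows c by (intro mult_left_mono) auto
        then have "73 / c1 * L \<le> N powr \<alpha>" using ev by linarith
        then show ?thesis using c by (simp add: field_simps)
      qed
      have n5: "512 * c2\<^sup>2 * L\<^sup>2 \<le> N powr (\<beta> - 2/3)"
      proof -
        have "512 * c2\<^sup>2 * L\<^sup>2 \<le> 512 * c2\<^sup>2 * L ^ 4" using pows by (intro mult_left_mono) auto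
        then show ?thesis using ev by linarith
      qed
      have n6: "50000000000 * L ^ 4 \<le> N powr (\<beta> - 1/2)" using ev by linarith
      have n7: "256 * L \<le> sqrt N" using ev pows N2 by (simp add: powr_half_sqrt)
      show ?case unfolding Let_def n(3)
      proof (intro allI impI, elim conjE)
        fix p :: nat and k b :: real and l :: nat and f
        assume p: "prime p" "c1 * real (2 * K) powr \<alpha> \<le> real p" "real p \<le> c2 * real (2 * K) powr \<alpha>"
          and k: "1 \<le> k" and b: "-1/2 \<le> b" "b \<le> 1/2" and H: "binH b = 1/k"
          and l: "real l \<le> k * real (2 * K) + real (2 * K) powr \<delta>"
          and loc: "is_local (sqrt (\<epsilon> * log 2 (real (2 * K)))) l (2 * K + 1) f"
        define q where "q = 1/2 - b"
        \<comment> \<open>Positive entropy rules out the deterministic biases, as the locale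
          demands.\<close>
        have "binH b > 0" using H k by simp
        moreover have "binH (1/2) = 0" "binH (-1/2) = 0" by (simp_all add: binH_def Let_def)
        ultimately have "b \<noteq> 1/2" "b \<noteq> -1/2" by (metis less_irrefl)+
        then have q: "0 < q" "q < 1" using b by (auto simp: q_def)
        obtain S where loc_S: "\<And>j. j < 2 * K + 1 \<Longrightarrow> S j \<subseteq> {..<l} \<and>
            real (card (S j)) \<le> sqrt (\<epsilon> * log 2 (real (2 * K))) \<and>
            (\<forall>x\<in>bitstrings l. \<forall>y\<in>bitstrings l. (\<forall>i\<in>S j. x i = y i) \<longrightarrow> f x j = f y j)"
          using loc unfolding is_local_def by metis
        interpret local_sampler l K q f S
          by unfold_locales (use n q loc_S in blast)+
        define D where "D = nat \<lfloor>sqrt (\<epsilon> * L)\<rfloor>"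
        have \<epsilon>L: "0 \<le> \<epsilon> * L" using \<beta> L1 by (simp add: \<epsilon>_def)
        have cD: "card (S j) \<le> D" if "j < 2 * K + 1" for j
          unfolding D_def L_def N_def by (rule le_nat_floor[OF conjunct1[OF conjunct2[OF loc_S[OF that]]]])
        have "real D \<le> sqrt (\<epsilon> * L)" using \<epsilon>L by (simp add: D_def)
        then have "(real D)\<^sup>2 \<le> (sqrt (\<epsilon> * L))\<^sup>2" by (intro power_mono) auto
        then have D2: "144 * (real D)\<^sup>2 \<le> (1 - \<beta>) * L" using \<epsilon>L by (simp add: \<epsilon>_def)
        have ent: "ent = ln 2 / k"
        proof -
          have "1/2 + b = 1 - q" by (simp add: q_def)
          then have "binH b = - ((1 - q) * log 2 (1 - q)) - q * log 2 q"
            unfolding binH_def Let_def using q by simp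
          then have "binH b * ln 2 = (- ((1 - q) * log 2 (1 - q)) - q * log 2 q) * ln 2" by simp
          also have "\<dots> = - ((1 - q) * (log 2 (1 - q) * ln 2)) - q * (log 2 q * ln 2)" by algebra
          also have "\<dots> = ent" by (simp add: ent_def log_def)
          finally show ?thesis using H by simp
        qed
        have "push (2 * K + 1) f (Bern_pow b l) = map_pmf out inp"
          unfolding push_def Bern_pow_def Bern_def out_def[abs_def] inp_def q_def[symmetric] ..
        moreover have "1/2 - (4 + c2) / L \<le> tv_dist (map_pmf out inp) (target_dist p (Suc K))"
          by (rule tv_dist_large[OF N_def L_def L1 cD D2 k ent _ p(1) _ _ c \<alpha>(2) \<beta>(1,2) \<delta>(2)
                n1 n2 n3 n4 n5 n6 n7]) (use l p in \<open>simp_all add: N_def\<close>)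
        ultimately show "1/2 - (4 + c2) / log 2 (real (2 * K))
            \<le> tv_dist (push (2 * K + 1) f (Bern_pow b l)) (target_dist p n)"
          unfolding n(2) by (simp add: L_def N_def)
      qed
    qed
  qed
qed

end
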